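(* Let $E_{10}$ denote the theoretical expected length of the random square-free walk in base $10$ that starts with the empty string. Then $$2.63297479 \;\le\; E_{10} \;\le\; 2.720303756.$$
   Context: A square-free integer is an integer that is not divisible by any perfect square other than $1$. A random square-free walk in base $b$ starts with the empty string; then randomly selected base-$b$ digits are appended to the right, one at a time, and the process stops when the number obtained is not square-free. $E_b$ denotes the theoretical expected length of such a walk in base $b$. No probabilistic assumption about the square-free numbers is made here: "square-free" refers to the actual square-free integers, not to a model in which each number is independently declared square-free with some probability. *)

theory Defs
  imports "HOL-Probability.Probability" "HOL-Computational_Algebra.Squarefree"
begin

text \<open>The number written by a string of base-\<open>b\<close> digits, most significant digit first; appending a
  digit \<open>d\<close> on the right turns \<open>n\<close> into \<open>b * n + d\<close>.\<close>

definition digits_value :: "nat \<Rightarrow> nat list \<Rightarrow> nat" where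
  "digits_value b ds = foldl (\<lambda>n d. b * n + d) 0 ds"

text \<open>The length of the walk that appends the digits of \<open>\<omega>\<close> one at a time: the number of digits
  appended up to and including the one whose appending makes the number non-square-free.
  The test takes place only after a digit has been appended, so the empty string is not tested.
  The number \<open>0\<close> is not square-free, so a walk whose first digit is \<open>0\<close> has length \<open>1\<close>.
  If the walk never stops, the infimum of the empty set gives length \<open>\<infinity>\<close>.\<close>

definition squarefree_walk_length :: "nat \<Rightarrow> nat stream \<Rightarrow> enat" where
  "squarefree_walk_length b \<omega> =
     (INF k\<in>{k. 0 < k \<and> \<not> squarefree (digits_value b (stake k \<omega>))}. enat k)"

text \<open>Independent digits, each uniformly distributed on \<open>{0, ..., b - 1}\<close> (the first one included).\<close>

definition random_digits :: "nat \<Rightarrow> nat stream measure" where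
  "random_digits b = stream_space (measure_pmf (pmf_of_set {..<b}))"

definition expected_squarefree_walk_length :: "nat \<Rightarrow> ennreal" where
  "expected_squarefree_walk_length b =
     (\<integral>\<^sup>+ \<omega>. ennreal_of_enat (squarefree_walk_length b \<omega>) \<partial>random_digits b)"

end

theory Submission
  imports Defs
begin

text \<open>The expected length is the sum over \<open>k\<close> of \<open>N k / 10 ^ k\<close>, where \<open>N k\<close> counts the strings of \<open>k\<close>
  digits all of whose nonempty prefixes are squarefree. Requiring only that no prefix is divisible
  by 4, 9 or 25 gives a process on residues modulo 90, whose counts are computed exactly. The
  difference between the two processes is the total weight of the strings at which the first one
  stops and the second one does not; such a string is divisible by the square of a prime \<open>p \<ge> 7\<close>.

  Upper bound: the strings of length 3 and 4 of this kind already suffice, together with a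
  geometric estimate of the tail. Lower bound: the series is cut after 10 digits. For strings with
  at most 7 digits and \<open>p < 1000\<close>, all multiples of \<open>p\<^sup>2\<close> are enumerated by rewriting and their weights are
  added up. For longer strings, a prefix of suitable length leaves an interval in which the
  multiples of \<open>p\<^sup>2\<close> not divisible by 4 are counted; for \<open>p > 1000\<close> the resulting estimates are
  summed over all odd numbers instead of primes.\<close>

section \<open>Chains of digits and their weighted counts\<close>

fun desc :: "(nat \<Rightarrow> bool) \<Rightarrow> nat \<Rightarrow> nat \<Rightarrow> nat" where
  "desc Q 0 n = 1"
| "desc Q (Suc j) n = (\<Sum>d<10. if Q (10 * n + d) then desc Q j (10 * n + d) else 0)"

text \<open>Up to the factor \<open>10 ^ j\<close>, which keeps it a natural number, this is the expected length of a walk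
  started at \<open>n\<close> and interrupted after \<open>j + 1\<close> digits.\<close>

fun wdesc :: "(nat \<Rightarrow> bool) \<Rightarrow> nat \<Rightarrow> nat \<Rightarrow> nat" where
  "wdesc Q 0 n = 1"
| "wdesc Q (Suc j) n = 10 ^ Suc j + (\<Sum>d<10. if Q (10 * n + d) then wdesc Q j (10 * n + d) else 0)"

text \<open>Strings of \<open>k\<close> digits, leading zeros included, correspond to the numbers
  below \<open>10 ^ k\<close>, so a string is represented by its value and its last digit is removed
  by \<open>div 10\<close>. The starting value 0 is exempt from the test \<open>Q\<close>.\<close>

fun chain :: "(nat \<Rightarrow> bool) \<Rightarrow> nat \<Rightarrow> nat set" where
  "chain Q 0 = {0}"
| "chain Q (Suc k) = {m. m div 10 \<in> chain Q k \<and> Q m}"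

text \<open>The index is one less than the number of digits of these strings.\<close>

definition killed :: "(nat \<Rightarrow> bool) \<Rightarrow> (nat \<Rightarrow> bool) \<Rightarrow> nat \<Rightarrow> nat set" where
  "killed P Q k = {m. m div 10 \<in> chain P k \<and> Q m \<and> \<not> P m}"

lemma bij_betw_children:
  "bij_betw (\<lambda>(n, d). 10 * n + d) (A \<times> {..<10}) {m::nat. m div 10 \<in> A}"
  by (rule bij_betw_byWitness[where f' = "\<lambda>m. (m div 10, m mod 10)"]) auto

lemma finite_children: "finite A \<Longrightarrow> finite {m::nat. m div 10 \<in> A}"
  using bij_betw_finite[OF bij_betw_children[of A]] by simp

lemma sum_children:
  fixes A :: "nat set" and w :: "nat \<Rightarrow> nat"
  assumes "finite A"
  shows "(\<Sum>m | m div 10 \<in> A \<and> Q m. w m) = (\<Sum>n\<in>A. \<Sum>d<10. if Q (10 * n + d) then w (10 * n + d) else 0)"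
proof -
  have "(\<Sum>m | m div 10 \<in> A \<and> Q m. w m) = (\<Sum>m | m div 10 \<in> A. if Q m then w m else 0)"
    by (subst sum.inter_filter[symmetric]) (auto simp: finite_children[OF assms])
  also have "\<dots> = (\<Sum>(n, d)\<in>A \<times> {..<10}. if Q (10 * n + d) then w (10 * n + d) else 0)"
    by (subst sum.reindex_bij_betw[OF bij_betw_children, symmetric]) (auto intro!: sum.cong)
  also have "\<dots> = (\<Sum>n\<in>A. \<Sum>d<10. if Q (10 * n + d) then w (10 * n + d) else 0)"
    by (simp add: sum.cartesian_product)
  finally show ?thesis .
qed

lemma finite_chain [simp]: "finite (chain Q k)"
proof (induction k)
  case (Suc k)
  then show ?case by (auto intro: finite_subset[OF _ finite_children[OF Suc]])
qed simp

lemma sum_desc_chain: "(\<Sum>n\<in>chain Q k. desc Q j n) = desc Q (k + j) 0"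
proof (induction k arbitrary: j)
  case (Suc k)
  have "(\<Sum>m\<in>chain Q (Suc k). desc Q j m) = (\<Sum>n\<in>chain Q k. desc Q (Suc j) n)"
    by (simp add: sum_children)
  then show ?case using Suc[of "Suc j"] by simp
qed simp

lemma card_chain: "card (chain Q k) = desc Q k 0"
  using sum_desc_chain[of Q 0 k] by simp

text \<open>One more digit scales the earlier contributions by 10 and adds the new survivors. Read
  backwards, this recovers the counts \<open>desc\<close> from tables of
  \<open>wdesc\<close>.\<close>

lemma wdesc_Suc_eq: "wdesc Q (Suc j) n = 10 * wdesc Q j n + desc Q (Suc j) n"
proof (induction j arbitrary: n)
  case (Suc j)
  have "(\<Sum>d<10. if Q (10 * n + d) then wdesc Q (Suc j) (10 * n + d) else 0)
      = (\<Sum>d<10. 10 * (if Q (10 * n + d) then wdesc Q j (10 * n + d) else 0)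
           + (if Q (10 * n + d) then desc Q (Suc j) (10 * n + d) else 0))"
    by (intro sum.cong) (auto simp only: Suc split: if_splits)
  also have "\<dots> = 10 * (\<Sum>d<10. if Q (10 * n + d) then wdesc Q j (10 * n + d) else 0)
      + desc Q (Suc (Suc j)) n"
    by (simp only: sum.distrib desc.simps(2)[of Q "Suc j"] flip: sum_distrib_left)
  finally have *: "(\<Sum>d<10. if Q (10 * n + d) then wdesc Q (Suc j) (10 * n + d) else 0)
      = 10 * (\<Sum>d<10. if Q (10 * n + d) then wdesc Q j (10 * n + d) else 0) + desc Q (Suc (Suc j)) n" .
  show ?case unfolding wdesc.simps(2)[of Q "Suc j" n] * wdesc.simps(2)[of Q j n] by simp
qed (simp cong: if_cong)

lemma wdesc_real: "real (wdesc Q j n) = 10 ^ j * (\<Sum>i\<le>j. desc Q i n / 10 ^ i)"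
proof (induction j)
  case (Suc j)
  then show ?case by (simp add: wdesc_Suc_eq algebra_simps del: wdesc.simps desc.simps(2))
qed simp

lemma desc_mono:
  assumes "\<And>m. P m \<Longrightarrow> Q m"
  shows "desc P j n \<le> desc Q j n"
  by (induction j arbitrary: n) (auto intro!: sum_mono simp: assms)

text \<open>A surviving string of \<open>a + b\<close> digits is a survivor of \<open>a\<close>
  digits with one of at most \<open>M\<close> continuations. This drives the geometric estimate of
  the tail.\<close>

lemma desc_add_le:
  assumes "\<And>m. desc Q b m \<le> M"
  shows "desc Q (a + b) n \<le> M * desc Q a n"
proof (induction a arbitrary: n)
  case 0
  then show ?case using assms by simp
next
  case (Suc a)
  then show ?case by (auto simp: sum_distrib_left intro!: sum_mono)
qed

lemma chain_mono:
  assumes "\<And>m. P m \<Longrightarrow> Q m"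
  shows "chain P k \<subseteq> chain Q k"
  by (induction k) (auto simp: assms)

lemma finite_killed [simp]: "finite (killed P Q k)"
  by (rule finite_subset[OF _ finite_children[of "chain P k"]]) (auto simp: killed_def)

lemma killed_subset_chain:
  assumes "\<And>m. P m \<Longrightarrow> Q m"
  shows "killed P Q k \<subseteq> chain Q (Suc k)"
  using chain_mono[of P Q k] assms by (auto simp: killed_def)

text \<open>One \<open>Q\<close>-step from the \<open>P\<close>-survivors splits into the
  \<open>P\<close>-survivors with one digit more and the freshly killed numbers. The former are
  treated by induction; the latter go on under \<open>Q\<close> for the remaining digits.\<close>

lemma wdesc_killed_aux:
  assumes PQ: "\<And>m. P m \<Longrightarrow> Q m"
  shows "(\<Sum>n\<in>chain P k. wdesc P j n) + (\<Sum>i<j. \<Sum>m\<in>killed P Q (k + i). wdesc Q (j - Suc i) m)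
       = (\<Sum>n\<in>chain P k. wdesc Q j n)"
proof (induction j arbitrary: k)
  case (Suc j)
  let ?c = "card (chain P k) * 10 ^ Suc j"
  have P: "(\<Sum>n\<in>chain P k. wdesc P (Suc j) n) = ?c + (\<Sum>m\<in>chain P (Suc k). wdesc P j m)"
    by (simp add: sum_children sum.distrib)
  have "{m. m div 10 \<in> chain P k \<and> Q m} = chain P (Suc k) \<union> killed P Q k"
    by (auto simp: killed_def PQ)
  moreover have "chain P (Suc k) \<inter> killed P Q k = {}"
    by (auto simp: killed_def)
  ultimately have "(\<Sum>m | m div 10 \<in> chain P k \<and> Q m. wdesc Q j m)
      = (\<Sum>m\<in>chain P (Suc k). wdesc Q j m) + (\<Sum>m\<in>killed P Q k. wdesc Q j m)"
    by (simp add: sum.union_disjoint del: chain.simps)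
  moreover have "(\<Sum>n\<in>chain P k. wdesc Q (Suc j) n)
      = ?c + (\<Sum>m | m div 10 \<in> chain P k \<and> Q m. wdesc Q j m)"
    by (simp add: sum_children sum.distrib)
  moreover have "(\<Sum>i<Suc j. \<Sum>m\<in>killed P Q (k + i). wdesc Q (Suc j - Suc i) m)
      = (\<Sum>m\<in>killed P Q k. wdesc Q j m)
        + (\<Sum>i<j. \<Sum>m\<in>killed P Q (Suc k + i). wdesc Q (j - Suc i) m)"
    by (subst sum.lessThan_Suc_shift) simp
  ultimately show ?case
    using P Suc[of "Suc k"] by (simp del: chain.simps wdesc.simps)
qed simp

text \<open>The identity is exact: bounding the killed weight from above bounds the
  \<open>P\<close>-process from below, and conversely.\<close>

lemma wdesc_killed:
  assumes "\<And>m. P m \<Longrightarrow> Q m"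
  shows "wdesc P j 0 + (\<Sum>i<j. \<Sum>m\<in>killed P Q i. wdesc Q (j - Suc i) m) = wdesc Q j 0"
  using wdesc_killed_aux[of P Q j 0, OF assms] by simp

lemma chain_less: "m \<in> chain Q k \<Longrightarrow> m < 10 ^ k"
proof (induction k arbitrary: m)
  case (Suc k)
  then have "m div 10 < 10 ^ k" by auto
  then show ?case by simp
qed simp

lemma chain_div: "s \<le> k \<Longrightarrow> m \<in> chain Q k \<Longrightarrow> m div 10 ^ s \<in> chain Q (k - s)"
proof (induction s arbitrary: m k)
  case (Suc s)
  then obtain k' where k: "k = Suc k'" by (cases k) auto
  have "m div 10 \<in> chain Q k'" using Suc k by simp
  then have "m div 10 div 10 ^ s \<in> chain Q (k' - s)" using Suc k by simp
  then show ?case by (simp add: k div_mult2_eq)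
qed simp

section \<open>Counting multiples in blocks of consecutive numbers\<close>

lemma card_nonmultiples_4_le: "card {j \<in> {a..<a + t}. \<not> 4 dvd j} \<le> t - t div (4::nat)"
proof -
  have "card ((\<lambda>k. 4 * ((a + 3) div 4 + k)) ` {..<t div 4}) = t div 4"
    by (subst card_image) (auto simp: inj_on_def)
  moreover have "(\<lambda>k. 4 * ((a + 3) div 4 + k)) ` {..<t div 4} \<subseteq> {j \<in> {a..<a + t}. 4 dvd j}"
    by auto
  ultimately have "t div 4 \<le> card {j \<in> {a..<a + t}. 4 dvd j}"
    by (metis (no_types, lifting) card_mono finite_Collect_conjI finite_atLeastLessThan
        finite_subset Collect_mem_eq mem_Collect_eq subsetI)
  moreover have "{j \<in> {a..<a + t}. \<not> 4 dvd j} = {a..<a + t} - {j \<in> {a..<a + t}. 4 dvd j}" by auto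
  moreover have "{j \<in> {a..<a + t}. 4 dvd j} \<subseteq> {a..<a + t}" by auto
  ultimately show ?thesis by (simp only: card_Diff_subset finite_subset[OF _ finite_atLeastLessThan])
      (simp add: diff_le_mono2)
qed

lemma le_mult_ceiling_div: "d > 0 \<Longrightarrow> L \<le> d * ((L + d - 1) div (d::nat))"
  using dividend_less_times_div[of d "L + d - 1"] by simp

text \<open>A block of \<open>L\<close> consecutive numbers contains at most \<open>t\<close>
  multiples \<open>d * j\<close>, where \<open>t\<close> is the quotient rounded up, and their
  \<open>j\<close> are consecutive. If 4 does not divide \<open>d * j\<close>, it does not divide
  \<open>j\<close>, which discards about a quarter of them.\<close>

lemma card_block_multiples:
  fixes L d n :: nat
  assumes "d > 0" "L > 0"
  defines "t \<equiv> (L + d - 1) div d"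
  shows "card {m. m div L = n \<and> d dvd m \<and> \<not> 4 dvd m} \<le> t - t div 4"
    and "finite {m. m div L = n \<and> d dvd m \<and> \<not> 4 dvd m}"
proof -
  \<comment> \<open>Again a quotient rounded up: \<open>d * a\<close> is the first multiple of
    \<open>d\<close> not below the start \<open>n * L\<close> of the block.\<close>
  define a where "a = (n * L + d - 1) div d"
  have sub: "{m. m div L = n \<and> d dvd m \<and> \<not> 4 dvd m} \<subseteq> (*) d ` {j \<in> {a..<a + t}. \<not> 4 dvd j}"
  proof safe
    fix m assume m: "n = m div L" "d dvd m" "\<not> 4 dvd m"
    then obtain j where j: "m = d * j" by auto
    have 1: "n * L \<le> m" "m < n * L + L"
      using m dividend_less_times_div[OF \<open>L > 0\<close>, of m] times_div_less_eq_dividend[of L m]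
      by (simp_all add: mult.commute)
    have "a \<le> j"
    proof -
      have "n * L + d - 1 < d * Suc j" using 1 j assms by simp
      then have "a < Suc j" unfolding a_def by (simp add: less_mult_imp_div_less mult.commute)
      then show ?thesis by simp
    qed
    moreover have "j < a + t"
    proof (rule ccontr)
      assume "\<not> j < a + t"
      then have "d * (a + t) \<le> m" using j by simp
      moreover have "d * a \<ge> n * L"
        unfolding a_def by (rule le_mult_ceiling_div) (rule assms)
      moreover have "d * t \<ge> L"
        unfolding t_def by (rule le_mult_ceiling_div) (rule assms)
      ultimately show False using 1 by (simp add: algebra_simps)
    qed
    moreover have "\<not> 4 dvd j" using m j by auto
    ultimately show "m \<in> (*) d ` {j \<in> {a..<a + t}. \<not> 4 dvd j}" using j by auto
  qed
  then show "finite {m. m div L = n \<and> d dvd m \<and> \<not> 4 dvd m}"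
    by (rule finite_subset) auto
  have "card {m. m div L = n \<and> d dvd m \<and> \<not> 4 dvd m} \<le> card {j \<in> {a..<a + t}. \<not> 4 dvd j}"
    using surj_card_le[OF _ sub] by simp
  also have "\<dots> \<le> t - t div 4" by (rule card_nonmultiples_4_le)
  finally show "card {m. m div L = n \<and> d dvd m \<and> \<not> 4 dvd m} \<le> t - t div 4" .
qed

text \<open>Cutting off the last \<open>s\<close> digits leaves a survivor with \<open>k - s\<close>
  digits, and each such prefix determines a block of \<open>10 ^ s\<close> numbers. A small
  \<open>s\<close> exploits the thinness of the survivors, a large one loses less by
  rounding.\<close>

lemma card_chain_multiples:
  assumes Q: "\<And>m. Q m \<Longrightarrow> \<not> 4 dvd m" and "s \<le> k" "k > 0" "d > 0"
  defines "t \<equiv> (10 ^ s + d - 1) div d"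
  shows "card {m \<in> chain Q k. d dvd m} \<le> desc Q (k - s) 0 * (t - t div 4)"
proof -
  let ?B = "\<lambda>n. {m. m div 10 ^ s = n \<and> d dvd m \<and> \<not> 4 dvd m}"
  have 4: "\<not> 4 dvd m" if "m \<in> chain Q k" for m
    using that Q \<open>k > 0\<close> by (cases k) auto
  have "{m \<in> chain Q k. d dvd m} \<subseteq> (\<Union>n\<in>chain Q (k - s). ?B n)"
    using chain_div[OF \<open>s \<le> k\<close>, of _ Q] 4 by auto
  then have "card {m \<in> chain Q k. d dvd m} \<le> card (\<Union>n\<in>chain Q (k - s). ?B n)"
    by (rule card_mono[rotated]) (auto intro!: card_block_multiples(2) assms)
  also have "\<dots> \<le> (\<Sum>n\<in>chain Q (k - s). card (?B n))"
    by (rule card_UN_le) simp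
  also have "\<dots> \<le> (\<Sum>n\<in>chain Q (k - s). t - t div 4)"
    unfolding t_def by (intro sum_mono card_block_multiples(1) assms) simp
  finally show ?thesis by (simp add: card_chain)
qed

text \<open>Each term \<open>1 / x\<^sup>2\<close> is at most
  \<open>1 / ((x - 1) * (x + 1))\<close>, and with step 2 these telescope.\<close>

lemma sum_inverse_odd_squares_le:
  assumes "a > 1"
  shows "(\<Sum>k<N. 1 / (real a + 2 * real k)\<^sup>2) \<le> (1 / (real a - 1) - 1 / (real a + 2 * real N - 1)) / 2"
proof (induction N)
  case (Suc N)
  let ?x = "real a + 2 * real N"
  have x: "?x > 1" using assms by simp
  have "1 / ?x\<^sup>2 \<le> 1 / ((?x - 1) * (?x + 1))"
  proof (rule divide_left_mono)
    show "(?x - 1) * (?x + 1) \<le> ?x\<^sup>2" by (simp add: power2_eq_square algebra_simps)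
    show "0 < ?x\<^sup>2 * ((?x - 1) * (?x + 1))" using x by (intro mult_pos_pos) auto
  qed simp
  also have "\<dots> = (1 / (?x - 1) - 1 / (?x + 1)) / 2"
  proof -
    have "?x - 1 \<noteq> 0" "?x + 1 \<noteq> 0" using x by linarith+
    then show ?thesis by (simp add: diff_frac_eq)
  qed
  finally show ?case using Suc by (simp add: algebra_simps)
qed simp

text \<open>The multiples in a block are estimated by the quotient plus 1. The quotients are summed
  by telescoping, the roundings add up to \<open>N\<close>.\<close>

lemma card_chain_odd_square_multiples:
  assumes Q: "\<And>m. Q m \<Longrightarrow> \<not> 4 dvd m" and "s \<le> k" "k > 0" "a > 1"
  shows "real (card {m \<in> chain Q k. \<exists>i<N. (a + 2 * i)\<^sup>2 dvd m})
    \<le> real (desc Q (k - s) 0) * (10 ^ s * ((1 / (real a - 1) - 1 / (real a + 2 * real N - 1)) / 2) + real N)"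
proof -
  have le: "real (card {m \<in> chain Q k. (a + 2 * i)\<^sup>2 dvd m})
     \<le> real (desc Q (k - s) 0) * (10 ^ s * (1 / (real a + 2 * real i)\<^sup>2) + 1)" for i
  proof -
    define d where "d = (a + 2 * i)\<^sup>2"
    have d: "d > 0" using assms by (simp add: d_def)
    have "card {m \<in> chain Q k. d dvd m} \<le> desc Q (k - s) 0 * ((10 ^ s + d - 1) div d)"
      using card_chain_multiples[of Q s k d, OF Q \<open>s \<le> k\<close> \<open>k > 0\<close> d]
      by (meson diff_le_self mult_le_mono2 order_trans)
    then have "real (card {m \<in> chain Q k. d dvd m}) \<le> real (desc Q (k - s) 0) * real ((10 ^ s + d - 1) div d)"
      by (metis of_nat_le_iff of_nat_mult)
    also have "real ((10 ^ s + d - 1) div d) \<le> real (10 ^ s + d - 1) / real d"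
      by (rule of_nat_div_le_of_nat)
    also have "\<dots> \<le> 10 ^ s * (1 / real d) + 1"
      using d by (simp add: field_simps of_nat_diff)
    finally show ?thesis unfolding d_def by (simp add: mult_left_mono)
  qed
  define M where "M i = {m \<in> chain Q k. (a + 2 * i)\<^sup>2 dvd m}" for i
  have "{m \<in> chain Q k. \<exists>i<N. (a + 2 * i)\<^sup>2 dvd m} = (\<Union>i\<in>{..<N}. M i)"
    by (auto simp: M_def)
  moreover have "card (\<Union>i\<in>{..<N}. M i) \<le> (\<Sum>i\<in>{..<N}. card (M i))"
    by (rule card_UN_le) simp
  ultimately have "real (card {m \<in> chain Q k. \<exists>i<N. (a + 2 * i)\<^sup>2 dvd m})
     \<le> (\<Sum>i<N. real (card {m \<in> chain Q k. (a + 2 * i)\<^sup>2 dvd m}))"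
    unfolding M_def[symmetric] by (metis of_nat_le_iff of_nat_sum)
  also have "\<dots> \<le> (\<Sum>i<N. real (desc Q (k - s) 0) * (10 ^ s * (1 / (real a + 2 * real i)\<^sup>2) + 1))"
    by (intro sum_mono le)
  also have "\<dots> = real (desc Q (k - s) 0) * (10 ^ s * (\<Sum>i<N. 1 / (real a + 2 * real i)\<^sup>2) + real N)"
    by (simp only: sum.distrib flip: sum_distrib_left) simp
  also have "\<dots> \<le> real (desc Q (k - s) 0) * (10 ^ s * ((1 / (real a - 1) - 1 / (real a + 2 * real N - 1)) / 2) + real N)"
    by (intro mult_left_mono add_right_mono sum_inverse_odd_squares_le assms) auto
  finally show ?thesis .
qed

section \<open>The count of strings surviving the moduli 4, 9 and 25\<close>

text \<open>Digits, and also residues modulo 9, are constructors, so that rewriting can match them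
  literally instead of calculating with numerals.\<close>

datatype dg = D0 | D1 | D2 | D3 | D4 | D5 | D6 | D7 | D8 | D9

fun vd :: "dg \<Rightarrow> nat" where
  "vd D0 = 0" | "vd D1 = 1" | "vd D2 = 2" | "vd D3 = 3" | "vd D4 = 4"
| "vd D5 = 5" | "vd D6 = 6" | "vd D7 = 7" | "vd D8 = 8" | "vd D9 = 9"

definition dv :: "nat \<Rightarrow> dg" where
  "dv n = (if n = 0 then D0 else if n = 1 then D1 else if n = 2 then D2 else if n = 3 then D3
    else if n = 4 then D4 else if n = 5 then D5 else if n = 6 then D6 else if n = 7 then D7
    else if n = 8 then D8 else D9)"

lemma vd_dv [simp]: "n < 10 \<Longrightarrow> vd (dv n) = n"
  by (simp add: dv_def)

lemma dv_vd [simp]: "dv (vd x) = x"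
  by (cases x) (simp_all add: dv_def)

lemma vd_less [simp]: "vd x < 10"
  by (cases x) simp_all

lemma dg_all: "(\<forall>x. P x) \<longleftrightarrow> P D0 \<and> P D1 \<and> P D2 \<and> P D3 \<and> P D4 \<and> P D5 \<and> P D6 \<and> P D7 \<and> P D8 \<and> P D9"
  by (metis dg.exhaust)

lemma bool_all: "(\<forall>x. P x) \<longleftrightarrow> P True \<and> P False"
  by (metis (full_types))

lemma sum_dg: "(\<Sum>d<10. f d) = (\<Sum>e\<leftarrow>[D0, D1, D2, D3, D4, D5, D6, D7, D8, D9]. f (vd e) :: nat)"
  by (simp add: lessThan_nat_numeral lessThan_Suc)

definition small_squarefree :: "nat \<Rightarrow> bool" where
  "small_squarefree m \<longleftrightarrow> \<not> 4 dvd m \<and> \<not> 9 dvd m \<and> \<not> 25 dvd m"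

definition pair_ok :: "dg \<Rightarrow> dg \<Rightarrow> bool" where
  "pair_ok x y \<longleftrightarrow> (10 * vd x + vd y) mod 4 \<noteq> 0 \<and> (10 * vd x + vd y) mod 25 \<noteq> 0"

definition res_add :: "dg \<Rightarrow> dg \<Rightarrow> dg option" where
  "res_add x s = (if (vd x + vd s) mod 9 = 0 then None else Some (dv ((vd x + vd s) mod 9)))"

text \<open>Since 4 and 25 divide 100, their tests see only the last two digits; since 10 is
  congruent to 1 modulo 9, appending a digit adds it to the residue. So the last digit and the
  residue modulo 9 are state enough.\<close>

lemma small_squarefree_append:
  assumes "d < 10"
  shows "small_squarefree (10 * n + d) \<longleftrightarrow>
    pair_ok (dv (n mod 10)) (dv d) \<and> res_add (dv d) (dv (n mod 9)) \<noteq> None"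
proof -
  have "10 * n + d = 100 * (n div 10) + (10 * (n mod 10) + d)"
    using div_mult_mod_eq[of n 10] by linarith
  then have c: "c dvd (10 * n + d) \<longleftrightarrow> (10 * (n mod 10) + d) mod c = 0" if "c dvd 100" for c
    by (metis dvd_add_right_iff dvd_mult2 dvd_eq_mod_eq_0 that)
  have "10 * n + d = 9 * (n + n div 9) + (d + n mod 9)" by simp
  then have "9 dvd (10 * n + d) \<longleftrightarrow> (d + n mod 9) mod 9 = 0"
    by (metis dvd_add_right_iff dvd_triv_left dvd_eq_mod_eq_0)
  moreover note c[of 4] c[of 25]
  ultimately show ?thesis
    using assms by (auto simp: small_squarefree_def pair_ok_def res_add_def
      less_trans[OF mod_less_divisor[of 9 n]])
qed

text \<open>Here \<open>s\<close> is the residue of the number modulo 9 and \<open>x\<close> its last digit.\<close>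

fun class_wdesc :: "nat \<Rightarrow> dg \<Rightarrow> dg \<Rightarrow> nat" where
  "class_wdesc 0 s x = 1"
| "class_wdesc (Suc j) s x = 10 ^ Suc j +
     (\<Sum>e\<leftarrow>[D0, D1, D2, D3, D4, D5, D6, D7, D8, D9].
        if pair_ok x e then case res_add e s of None \<Rightarrow> 0 | Some s' \<Rightarrow> class_wdesc j s' e else 0)"

lemma wdesc_class:
  "wdesc small_squarefree j n = class_wdesc j (dv (n mod 9)) (dv (n mod 10))"
proof (induction j arbitrary: n)
  case (Suc j)
  have "(if small_squarefree (10 * n + vd e) then wdesc small_squarefree j (10 * n + vd e) else 0)
    = (if pair_ok (dv (n mod 10)) e
        then case res_add e (dv (n mod 9)) of None \<Rightarrow> 0 | Some s' \<Rightarrow> class_wdesc j s' e else 0)" for e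
  proof -
    have "10 * n + vd e = (vd e + n mod 9) + 9 * (n + n div 9)" by simp
    then have "(10 * n + vd e) mod 9 = (vd e + n mod 9) mod 9" by (metis mod_mult_self2)
    moreover have "(10 * n + vd e) mod 10 = vd e" by simp
    ultimately show ?thesis
      by (auto simp: small_squarefree_append Suc res_add_def less_trans[OF mod_less_divisor[of 9 n]]
          split: option.split)
  qed
  then show ?case by (simp only: wdesc.simps class_wdesc.simps sum_dg)
qed simp

text \<open>Expanding the quantifiers over digits turns such an equation into a table of ground rewrite
  rules, which makes the later evaluations by rewriting feasible.\<close>

lemma pair_ok_all: "\<forall>x y. pair_ok x y \<longleftrightarrow>
    (10 * vd x + vd y) mod 4 \<noteq> 0 \<and> (10 * vd x + vd y) mod 25 \<noteq> 0"
  by (simp add: pair_ok_def)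

lemmas pair_ok_table = pair_ok_all[unfolded dg_all, simplified]

lemma res_add_all: "\<forall>x s. res_add x s = (if (vd x + vd s) mod 9 = 0 then None else Some (dv ((vd x + vd s) mod 9)))"
  by (simp add: res_add_def)

lemmas res_add_table = res_add_all[unfolded dg_all, simplified dv_def, simplified]

lemma class_wdesc_all: "\<forall>s x. class_wdesc (numeral k) s x = 10 ^ numeral k +
     (\<Sum>e\<leftarrow>[D0, D1, D2, D3, D4, D5, D6, D7, D8, D9].
        if pair_ok x e then case res_add e s of None \<Rightarrow> 0 | Some s' \<Rightarrow> class_wdesc (pred_numeral k) s' e else 0)"
  by (simp add: numeral_eq_Suc)

lemma class_wdesc_all_1: "\<forall>s x. class_wdesc 1 s x = 10 +
     (\<Sum>e\<leftarrow>[D0, D1, D2, D3, D4, D5, D6, D7, D8, D9].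
        if pair_ok x e then case res_add e s of None \<Rightarrow> 0 | Some s' \<Rightarrow> 1 else 0)"
  unfolding One_nat_def class_wdesc.simps power_Suc0_right by (intro allI refl)

lemmas table_simps = pair_ok_table res_add_table list.map sum_list.Cons sum_list.Nil option.case
  if_True if_False pred_numeral_simps BitM.simps numeral_One power_numeral pow.simps Num.sqr.simps
  mult_num_simps numeral_plus_numeral add_num_simps add_0_left add_0_right add_numeral_special one_add_one

text \<open>Tables of the values for all 100 pairs of arguments. Each is computed from its
  predecessor, so the branching recursion is never unfolded more than one level.\<close>

lemmas class_wdesc_1 = class_wdesc_all_1[unfolded dg_all, simplified table_simps]
lemmas class_wdesc_2 =
  class_wdesc_all[of "num.Bit0 num.One", unfolded dg_all, simplified table_simps class_wdesc_1]
lemmas class_wdesc_3 =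
  class_wdesc_all[of "num.Bit1 num.One", unfolded dg_all, simplified table_simps class_wdesc_2]
lemmas class_wdesc_4 =
  class_wdesc_all[of "num.Bit0 (num.Bit0 num.One)", unfolded dg_all, simplified table_simps class_wdesc_3]
lemmas class_wdesc_5 =
  class_wdesc_all[of "num.Bit1 (num.Bit0 num.One)", unfolded dg_all, simplified table_simps class_wdesc_4]
lemmas class_wdesc_6 =
  class_wdesc_all[of "num.Bit0 (num.Bit1 num.One)", unfolded dg_all, simplified table_simps class_wdesc_5]
lemmas class_wdesc_7 =
  class_wdesc_all[of "num.Bit1 (num.Bit1 num.One)", unfolded dg_all, simplified table_simps class_wdesc_6]
lemmas class_wdesc_8 =
  class_wdesc_all[of "num.Bit0 (num.Bit0 (num.Bit0 num.One))", unfolded dg_all, simplified table_simps class_wdesc_7]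
lemmas class_wdesc_9 =
  class_wdesc_all[of "num.Bit1 (num.Bit0 (num.Bit0 num.One))", unfolded dg_all, simplified table_simps class_wdesc_8]
lemmas class_wdesc_10 =
  class_wdesc_all[of "num.Bit0 (num.Bit1 (num.Bit0 num.One))", unfolded dg_all, simplified table_simps class_wdesc_9]
lemmas class_wdesc_11 =
  class_wdesc_all[of "num.Bit1 (num.Bit1 (num.Bit0 num.One))", unfolded dg_all, simplified table_simps class_wdesc_10]
lemmas class_wdesc_12 =
  class_wdesc_all[of "num.Bit0 (num.Bit0 (num.Bit1 num.One))", unfolded dg_all, simplified table_simps class_wdesc_11]
lemmas class_wdesc_13 =
  class_wdesc_all[of "num.Bit1 (num.Bit0 (num.Bit1 num.One))", unfolded dg_all, simplified table_simps class_wdesc_12]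

section \<open>Decimal digit strings and the enumeration of multiples\<close>

text \<open>The least significant digit comes first, so that carries run along the list and
  appending a digit to the number is \<open>Cons\<close>.\<close>

fun val :: "dg list \<Rightarrow> nat" where
  "val [] = 0"
| "val (x # xs) = vd x + 10 * val xs"

function digs :: "nat \<Rightarrow> dg list" where
  "digs n = (if n = 0 then [] else dv (n mod 10) # digs (n div 10))"
  by auto
termination by (relation "Wellfounded.measure (\<lambda>n. n)") auto

declare digs.simps [simp del]

lemma digs_0 [simp]: "digs 0 = []"
  by (simp add: digs.simps)

lemma digs_pos: "n > 0 \<Longrightarrow> digs n = dv (n mod 10) # digs (n div 10)"
  by (simp add: digs.simps[of n])

lemma val_digs [simp]: "val (digs n) = n"
proof (induction n rule: less_induct)
  case (less n)
  then show ?case by (cases "n = 0") (simp_all add: digs_pos)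
qed

definition dg_add :: "bool \<Rightarrow> dg \<Rightarrow> dg \<Rightarrow> dg \<times> bool" where
  "dg_add c x y = (dv ((vd x + vd y + of_bool c) mod 10), 10 \<le> vd x + vd y + of_bool c)"

fun digs_add :: "bool \<Rightarrow> dg list \<Rightarrow> dg list \<Rightarrow> dg list" where
  "digs_add c [] [] = (if c then [D1] else [])"
| "digs_add c (x # xs) [] = (case dg_add c x D0 of (d, c') \<Rightarrow> d # digs_add c' xs [])"
| "digs_add c [] (y # ys) = (case dg_add c D0 y of (d, c') \<Rightarrow> d # digs_add c' [] ys)"
| "digs_add c (x # xs) (y # ys) = (case dg_add c x y of (d, c') \<Rightarrow> d # digs_add c' xs ys)"

lemma digs_add_digs: "digs_add c (digs a) (digs b) = digs (a + b + of_bool c)"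
proof (induction "a + b" arbitrary: a b c rule: less_induct)
  case less
  show ?case
  proof (cases "a + b = 0")
    case True
    then show ?thesis by (auto simp: digs_pos dv_def)
  next
    case False
    let ?s = "a mod 10 + b mod 10 + of_bool c"
    have sum: "a + b + of_bool c = 10 * (a div 10 + b div 10) + ?s" by simp
    have q: "(a + b + of_bool c) div 10 = a div 10 + b div 10 + of_bool (10 \<le> ?s)"
      and r: "(a + b + of_bool c) mod 10 = ?s mod 10"
    proof -
      have "?s < 20"
        using mod_less_divisor[of 10 a] mod_less_divisor[of 10 b] by (cases c; simp)
      then have "?s div 10 = of_bool (10 \<le> ?s)" by (cases "10 \<le> ?s") (simp_all add: div_nat_eqI)
      then show "(a + b + of_bool c) div 10 = a div 10 + b div 10 + of_bool (10 \<le> ?s)"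
        "(a + b + of_bool c) mod 10 = ?s mod 10"
        unfolding sum by (simp_all only: div_mult_self4 mod_mult_self4 div_mult_self2)
    qed
    have "10 * (a div 10) \<le> a" "10 * (b div 10) \<le> b" by simp_all
    then have "a div 10 + b div 10 < a + b" using False by linarith
    note IH = less[OF this]
    have "dv 0 = D0" by (simp add: dv_def)
    then have "digs_add c (digs a) (digs b)
        = dv (?s mod 10) # digs_add (10 \<le> ?s) (digs (a div 10)) (digs (b div 10))"
      using False by (cases "a = 0"; cases "b = 0") (auto simp: digs_pos dg_add_def)
    then show ?thesis
      using False IH by (simp add: digs_pos[of "a + b + of_bool c"] q r)
  qed
qed

text \<open>Names the continuation of an addition, so that its rule for
  \<open>carry (d, c) xs ys\<close> fires only after the digit sum has been looked up.\<close>

definition carry :: "dg \<times> bool \<Rightarrow> dg list \<Rightarrow> dg list \<Rightarrow> dg list" where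
  "carry p xs ys = fst p # digs_add (snd p) xs ys"

lemma digs_add_Nil: "digs_add False xs [] = xs" "digs_add False [] ys = ys"
proof -
  have "dg_add False x D0 = (x, False)" "dg_add False D0 x = (x, False)" for x
    by (cases x; simp add: dg_add_def dv_def)+
  then show "digs_add False xs [] = xs" "digs_add False [] ys = ys"
    by (induction xs, auto) (induction ys, auto)
qed

text \<open>A carry into a first summand that is exhausted before the second does not occur: in a
  walk from 0, the first summand is 0 or a positive multiple of the second.\<close>

lemma digs_add_rules:
  "digs_add c [] [] = (if c then [D1] else [])"
  "digs_add True (x # xs) [] = carry (dg_add True x D0) xs []"
  "digs_add c (x # xs) (y # ys) = carry (dg_add c x y) xs ys"
  "carry (d, c) xs ys = d # digs_add c xs ys"
  by (simp_all add: carry_def case_prod_unfold)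

lemma dg_add_all: "\<forall>c x y. dg_add c x y
    = (dv ((vd x + vd y + of_bool c) mod 10), 10 \<le> vd x + vd y + of_bool c)"
  by (simp add: dg_add_def)

lemmas dg_add_table = dg_add_all[unfolded dg_all bool_all, simplified dv_def vd.simps of_bool_eq, simplified]

text \<open>Of the seven non-squarefree numbers with three digits that pass all tests modulo 4, 9 and
  25, at most one begins with a given pair of digits.\<close>

definition excluded_last :: "dg \<Rightarrow> dg \<Rightarrow> dg option" where
  "excluded_last x y = map_of [((D1, D4), D7), ((D2, D9), D4), ((D3, D3), D8), ((D3, D4), D3),
     ((D5, D3), D9), ((D5, D7), D8), ((D7, D3), D5)] (x, y)"

text \<open>The leading digits stand at the end of the list, so the recursion drops low digits until
  three are left.\<close>

fun prefix_ok :: "dg list \<Rightarrow> bool" where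
  "prefix_ok [z, y, x] \<longleftrightarrow> excluded_last x y \<noteq> Some z"
| "prefix_ok (w # z # y # x # xs) \<longleftrightarrow> prefix_ok (z # y # x # xs)"
| "prefix_ok xs \<longleftrightarrow> True"

fun pairs_ok :: "dg \<Rightarrow> dg list \<Rightarrow> bool" where
  "pairs_ok y [] \<longleftrightarrow> pair_ok D0 y"
| "pairs_ok y (x # xs) \<longleftrightarrow> pair_ok x y \<and> pairs_ok x xs"

definition opt_res_add :: "dg \<Rightarrow> dg option \<Rightarrow> dg option" where
  "opt_res_add x r = Option.bind r (res_add x)"

fun residue :: "dg list \<Rightarrow> dg option" where
  "residue [] = Some D0"
| "residue (x # xs) = opt_res_add x (residue xs)"

text \<open>The loss computed from the digits alone, with \<open>10 - length\<close> digits still to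
  come. The tests need only be necessary for being killed, since overcounting is harmless for a
  lower bound. \<open>prefix_ok\<close> is asked of \<open>xs\<close> and not of
  \<open>x # xs\<close>: a killed number may itself be excluded, its proper prefixes may
  not.\<close>

fun weight :: "dg list \<Rightarrow> nat" where
  "weight [] = 0"
| "weight (x # xs) =
    (if pairs_ok x xs \<and> prefix_ok xs
     then case residue (x # xs) of None \<Rightarrow> 0 | Some s \<Rightarrow> class_wdesc (10 - length (x # xs)) s x else 0)"

text \<open>\<open>residue\<close> and \<open>pairs_ok\<close> replay the tests of all prefixes. The
  length is exactly \<open>k\<close> because 0 is divisible by 4, which rules out a leading
  zero.\<close>

lemma digs_chain_small:
  "m \<in> chain small_squarefree k \<Longrightarrow> residue (digs m) = Some (dv (m mod 9)) \<and> length (digs m) = k \<and>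
     (case digs m of [] \<Rightarrow> True | x # xs \<Rightarrow> pairs_ok x xs)"
proof (induction k arbitrary: m)
  case 0
  then show ?case by (simp add: dv_def)
next
  case (Suc k)
  define n where "n = m div 10"
  define d where "d = m mod 10"
  have n: "n \<in> chain small_squarefree k" and sm: "small_squarefree m" using Suc.prems by (auto simp: n_def)
  then have m0: "m > 0" by (auto simp: small_squarefree_def intro: Nat.gr0I)
  have d: "d < 10" and md: "m = 10 * n + d" by (simp_all add: n_def d_def)
  have dm: "digs m = dv d # digs n" using digs_pos[OF m0] by (simp add: n_def d_def)
  have ok: "pair_ok (dv (n mod 10)) (dv d)" "res_add (dv d) (dv (n mod 9)) \<noteq> None"
    using sm small_squarefree_append[OF d, of n] md by auto
  have "m = (d + n mod 9) + 9 * (n + n div 9)" using md by simp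
  then have "m mod 9 = (d + n mod 9) mod 9" by (metis mod_mult_self2)
  then have res: "res_add (dv d) (dv (n mod 9)) = Some (dv (m mod 9))"
    using ok d by (auto simp: res_add_def less_trans[OF mod_less_divisor[of 9 n]] split: if_splits)
  have "pairs_ok (dv d) (digs n)"
  proof (cases "n = 0")
    case True
    then show ?thesis using ok by (simp add: dv_def)
  next
    case False
    then show ?thesis using ok Suc.IH[OF n] by (simp add: digs_pos)
  qed
  then show ?case using Suc.IH[OF n] res by (simp add: dm opt_res_add_def)
qed

lemma excluded_last_not_squarefree:
  assumes "excluded_last x y = Some z"
  shows "\<not> squarefree (vd z + 10 * (vd y + 10 * vd x))"
proof -
  have sq: "\<not> squarefree (n :: nat)" if "d\<^sup>2 dvd n" "d \<noteq> 1" for n d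
    using that by (auto simp: squarefree_def)
  from assms have "(x, y, z) \<in> {(D1, D4, D7), (D2, D9, D4), (D3, D3, D8), (D3, D4, D3),
     (D5, D3, D9), (D5, D7, D8), (D7, D3, D5)}"
    unfolding excluded_last_def by (auto split: if_splits)
  then show ?thesis
    using sq[of 7 147] sq[of 7 294] sq[of 13 338] sq[of 7 343] sq[of 7 539] sq[of 17 578] sq[of 7 735]
    by auto
qed

lemma prefix_ok_Cons: "prefix_ok xs \<Longrightarrow> length xs \<noteq> 2 \<Longrightarrow> prefix_ok (x # xs)"
  by (cases xs rule: prefix_ok.cases) auto

lemma prefix_ok_chain: "n \<in> chain squarefree k \<Longrightarrow> prefix_ok (digs n)"
proof (induction k arbitrary: n)
  case (Suc k)
  have n: "n div 10 \<in> chain squarefree k" "squarefree n" using Suc.prems by auto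
  then have n0: "n > 0" by (auto intro: Nat.gr0I)
  have dm: "digs n = dv (n mod 10) # digs (n div 10)" by (rule digs_pos[OF n0])
  have IH: "prefix_ok (digs (n div 10))" by (rule Suc.IH[OF n(1)])
  show ?case
  proof (cases "\<exists>z y x. digs n = [z, y, x]")
    case True
    then obtain z y x where zyx: "digs n = [z, y, x]" by auto
    then have "n = vd z + 10 * (vd y + 10 * vd x)" using val_digs[of n] by simp
    then show ?thesis using n(2) excluded_last_not_squarefree[of x y z] zyx by auto
  next
    case False
    then have "length (digs (n div 10)) \<noteq> 2"
      unfolding dm by (auto simp: length_Suc_conv numeral_2_eq_2)
    then show ?thesis unfolding dm by (rule prefix_ok_Cons[OF IH])
  qed
qed simp

lemma weight_killed:
  assumes "m \<in> killed squarefree small_squarefree k"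
    and PQ: "\<And>m. squarefree m \<Longrightarrow> small_squarefree m"
  shows "weight (digs m) = wdesc small_squarefree (10 - Suc k) m" and "length (digs m) = Suc k"
proof -
  have ch: "m \<in> chain small_squarefree (Suc k)"
    using killed_subset_chain[of squarefree small_squarefree k] PQ assms by blast
  have pre: "prefix_ok (digs (m div 10))"
    using assms by (auto simp: killed_def intro!: prefix_ok_chain)
  have "m > 0" using ch by (auto simp: small_squarefree_def intro: Nat.gr0I)
  then show "weight (digs m) = wdesc small_squarefree (10 - Suc k) m"
    using digs_chain_small[OF ch] pre
    by (simp add: digs_pos[of m] wdesc_class del: residue.simps)
  show "length (digs m) = Suc k" using digs_chain_small[OF ch] by simp
qed

section \<open>Running through the multiples of a square by rewriting\<close>

definition visit :: "dg list \<Rightarrow> dg list \<times> nat" where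
  "visit m = (m, weight m)"

text \<open>Returning the number reached together with the weight collected on the way, rather than
  threading an accumulator, keeps the terms small during rewriting.\<close>

fun walk :: "nat \<Rightarrow> dg list \<Rightarrow> dg list \<Rightarrow> dg list \<times> nat" where
  "walk 0 q m = (m, 0)"
| "walk (Suc n) q m = (let (m', w) = walk n q m; (m'', w') = visit (digs_add False m' q) in (m'', w + w'))"

lemma walk_digs:
  "walk n (digs q) (digs a) = (digs (a + n * q), \<Sum>i\<in>{1..n}. weight (digs (a + i * q)))"
proof (induction n)
  case (Suc n)
  then show ?case using digs_add_digs[of False "a + n * q" q]
    by (simp add: visit_def add_ac)
qed simp

definition walk_then :: "nat \<Rightarrow> dg list \<Rightarrow> dg list \<times> nat \<Rightarrow> dg list \<times> nat" where
  "walk_then n q s = (let (m, w) = walk n q (fst s) in (m, snd s + w))"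

definition add_weight :: "nat \<Rightarrow> dg list \<times> nat \<Rightarrow> dg list \<times> nat" where
  "add_weight w s = (fst s, w + snd s)"

lemma walk_add: "walk (a + b) q m = walk_then a q (walk b q m)"
  by (induction a) (auto simp: walk_then_def split: prod.split)

lemma walk_1: "walk 1 q m = visit (digs_add False m q)"
  by (simp add: visit_def)

text \<open>The number of steps is halved along its binary digits. As \<open>walk_then\<close> fires
  only on an evaluated pair, the first half of a walk is finished before the second begins.\<close>

lemma walk_rules:
  "walk (numeral num.One) q m = visit (digs_add False m q)"
  "walk (numeral (num.Bit0 n)) q m = walk_then (numeral n) q (walk (numeral n) q m)"
  "walk (numeral (num.Bit1 n)) q m
     = walk_then (numeral n) q (walk_then (numeral n) q (visit (digs_add False m q)))"
  "walk_then j q (m, w) = add_weight w (walk j q m)"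
  "add_weight 0 s = s"
  "add_weight (numeral k) (m, 0) = (m, numeral k)"
  "add_weight (numeral k) (m, numeral l) = (m, numeral (k + l))"
proof -
  have "walk (numeral (num.Bit1 n)) q m = walk (numeral n + (numeral n + 1)) q m"
    by (simp only: numeral_Bit1 add.assoc)
  then show "walk (numeral (num.Bit1 n)) q m
     = walk_then (numeral n) q (walk_then (numeral n) q (visit (digs_add False m q)))"
    by (simp only: walk_add walk_1)
qed (simp_all only: numeral_One numeral_Bit0 walk_add walk_1,
     simp_all add: walk_then_def add_weight_def case_prod_unfold Let_def)

text \<open>The nested conditionals of \<open>weight\<close> are cut into functions that each wait
  for one decided test. The cheap test of digit pairs discards many numbers before residue and
  prefix are computed.\<close>

definition visit_residue :: "dg option \<Rightarrow> dg \<Rightarrow> dg list \<Rightarrow> nat" where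
  "visit_residue r x m = (if prefix_ok m
     then case r of None \<Rightarrow> 0 | Some s \<Rightarrow> class_wdesc (10 - length (x # m)) s x else 0)"

definition visit_pairs :: "bool \<Rightarrow> dg \<Rightarrow> dg list \<Rightarrow> nat" where
  "visit_pairs b x m = (if b then visit_residue (residue (x # m)) x m else 0)"

definition visit_prefix :: "bool \<Rightarrow> dg \<Rightarrow> dg \<Rightarrow> dg list \<Rightarrow> nat" where
  "visit_prefix b s x m = (if b then class_wdesc (10 - length (x # m)) s x else 0)"

definition pairs_ok_if :: "bool \<Rightarrow> dg \<Rightarrow> dg list \<Rightarrow> bool" where
  "pairs_ok_if b x xs \<longleftrightarrow> b \<and> pairs_ok x xs"

definition differs :: "dg option \<Rightarrow> dg \<Rightarrow> bool" where
  "differs r z \<longleftrightarrow> r \<noteq> Some z"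

text \<open>\<open>visit_prefix\<close> is evaluated for three to seven digits only: the shorter
  multiples of the squares in question are 49 and 98, which already fail at their first digits 4 and
  9.\<close>

lemma visit_rules:
  "visit (x # m) = (x # m, visit_pairs (pairs_ok x m) x m)"
  "visit_pairs False x m = 0"
  "visit_pairs True x m = visit_residue (residue (x # m)) x m"
  "visit_residue None x m = 0"
  "visit_residue (Some s) x m = visit_prefix (prefix_ok m) s x m"
  "visit_prefix False s x m = 0"
  "visit_prefix True s x [a, b] = class_wdesc 7 s x"
  "visit_prefix True s x [a, b, c] = class_wdesc 6 s x"
  "visit_prefix True s x [a, b, c, d] = class_wdesc 5 s x"
  "visit_prefix True s x [a, b, c, d, e] = class_wdesc 4 s x"
  "visit_prefix True s x [a, b, c, d, e, f] = class_wdesc 3 s x"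
  "pairs_ok y [] = pair_ok D0 y"
  "pairs_ok y (x # xs) = pairs_ok_if (pair_ok x y) x xs"
  "pairs_ok_if False x xs = False"
  "pairs_ok_if True x xs = pairs_ok x xs"
  "opt_res_add x None = None"
  "opt_res_add x (Some s) = res_add x s"
  "prefix_ok [z, y, x] = differs (excluded_last x y) z"
  "prefix_ok (w # z # y # x # xs) = prefix_ok (z # y # x # xs)"
  "prefix_ok [y, x] = True"
  "differs None z = True"
  by (auto simp: visit_def visit_pairs_def visit_residue_def visit_prefix_def
      pairs_ok_if_def opt_res_add_def differs_def simp del: class_wdesc.simps residue.simps split: option.split)

lemma excluded_last_all: "\<forall>x y. excluded_last x y = map_of [((D1, D4), D7), ((D2, D9), D4),
     ((D3, D3), D8), ((D3, D4), D3), ((D5, D3), D9), ((D5, D7), D8), ((D7, D3), D5)] (x, y)"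
  by (simp add: excluded_last_def)

lemma differs_Some_all: "\<forall>w z. differs (Some w) z \<longleftrightarrow> w \<noteq> z"
  by (simp add: differs_def)

lemmas differs_table = differs_Some_all[unfolded dg_all, simplified]

lemmas excluded_last_table = excluded_last_all[unfolded dg_all, simplified]

fun enum :: "(nat \<times> dg list) list \<Rightarrow> dg list \<times> nat" where
  "enum [] = ([], 0)"
| "enum ((n, q) # r) = add_weight (snd (walk n q [])) (enum r)"

definition add_walk :: "dg list \<times> nat \<Rightarrow> dg list \<times> nat \<Rightarrow> dg list \<times> nat" where
  "add_walk s t = add_weight (snd s) t"

lemma enum_rules:
  "enum [] = ([], 0)"
  "enum ((n, q) # r) = add_walk (walk n q []) (enum r)"
  "add_walk (m, w) t = add_weight w t"
  by (simp_all add: add_walk_def)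

lemmas enum_simps = dg_add_table digs_add_Nil digs_add_rules if_True if_False pair_ok_table
  res_add_table residue.simps excluded_last_table differs_table visit_rules walk_1 walk_rules enum_rules
  class_wdesc_3 class_wdesc_4 class_wdesc_5 class_wdesc_6 class_wdesc_7
  add_num_simps


section \<open>The primes from 7 to 997 and the multiples of their squares\<close>

definition squares :: "nat list \<Rightarrow> (nat \<times> dg list) list" where
  "squares ps = map (\<lambda>p. ((10 ^ 7 - 1) div p\<^sup>2, digs (p\<^sup>2))) ps"

definition square_weight :: "nat \<Rightarrow> nat" where
  "square_weight p = (\<Sum>i\<in>{1..(10 ^ 7 - 1) div p\<^sup>2}. weight (digs (i * p\<^sup>2)))"

lemma enum_squares: "snd (enum (squares ps)) = (\<Sum>p\<leftarrow>ps. square_weight p)"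
proof (induction ps)
  case (Cons p ps)
  have "snd (walk n (digs q) []) = (\<Sum>i\<in>{1..n}. weight (digs (i * q)))" for n q
    using walk_digs[of n q 0] by simp
  then show ?case using Cons by (simp add: squares_def square_weight_def add_weight_def)
qed (simp add: squares_def)

text \<open>The suffix of these names is the number of trailing digits cut off in
  \<open>sum_killed_sieve_le\<close>. The pieces of \<open>primes_3\<close> match the separate
  evaluations below.\<close>

definition primes_3 :: "nat list" where
  "primes_3 = [7] @ [11] @ [13, 17] @ [19, 23]"

definition primes_4 :: "nat list" where
  "primes_4 = [29, 31, 37, 41, 43, 47, 53, 59, 61, 67, 71, 73]"

definition primes_5 :: "nat list" where
  "primes_5 = [79, 83, 89, 97, 101, 103, 107, 109, 113, 127, 131, 137, 139, 149, 151, 157, 163, 167,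
    173, 179, 181, 191, 193, 197, 199]"

definition primes_6 :: "nat list" where
  "primes_6 =
    [211, 223, 227, 229, 233, 239, 241, 251, 257, 263, 269, 271, 277, 281, 283, 293, 307,
    311, 313, 317, 331, 337, 347, 349, 353, 359, 367, 373, 379, 383, 389, 397, 401, 409,
    419, 421, 431, 433, 439, 443, 449, 457, 461, 463, 467, 479, 487, 491, 499, 503, 509,
    521, 523, 541, 547, 557, 563, 569, 571, 577, 587, 593, 599, 601, 607, 613, 617, 619,
    631, 641, 643, 647, 653, 659, 661, 673, 677, 683, 691, 701, 709, 719, 727, 733, 739,
    743, 751, 757, 761, 769, 773, 787, 797, 809, 811, 821, 823, 827, 829, 839, 853, 857,
    859, 863, 877, 881, 883, 887, 907, 911, 919, 929, 937, 941, 947, 953, 967, 971, 977,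
    983, 991, 997]"

definition sieve_primes :: "nat list" where
  "sieve_primes = primes_3 @ primes_4 @ primes_5 @ primes_6"

text \<open>Trial division up to 31 suffices below 1000, as \<open>37\<^sup>2 > 1000\<close>; the
  divisors 2, 3 and 5 are handled by residues modulo 30.\<close>

definition sieved :: "nat \<Rightarrow> bool" where
  "sieved n \<longleftrightarrow> (\<forall>d\<in>{7, 11, 13, 17, 19, 23, 29, 31}. d dvd n \<longrightarrow> d = n)"

text \<open>A finite check of the \<open>34 * 8\<close> candidates coprime to 30. The last
  alternative takes care of those from 1001 to 1019.\<close>

lemma sieved_cases:
  assumes "k < 34" "r \<in> {1, 7, 11, 13, 17, 19, 23, 29}"
  shows "30 * k + r = 1 \<or> 30 * k + r \<in> set sieve_primes \<or> \<not> sieved (30 * k + r)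
    \<or> 1000 \<le> 30 * k + r"
proof -
  have "k \<in> {0, 1, 2, 3, 4, 5, 6, 7, 8, 9, 10, 11, 12, 13, 14, 15, 16, 17, 18, 19, 20, 21,
      22, 23, 24, 25, 26, 27, 28, 29, 30, 31, 32, 33}"
    using assms(1) unfolding insert_iff empty_iff by arith
  then show ?thesis
    using assms(2) unfolding sieve_primes_def primes_3_def primes_4_def primes_5_def primes_6_def
    apply (elim insertE emptyE)
    \<comment> \<open>Comparing numerals syntactically settles the candidates in the list;
      divisibility and order are left to the next step.\<close>
    apply (simp_all only: mult_zero_right mult_1_right add_0_left numeral_times_numeral
        numeral_plus_numeral numeral_plus_one mult_num_simps add_num_simps numeral_eq_iff
        numeral_eq_one_iff one_eq_numeral_iff num.inject num.distinct list.set set_append Un_iff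
        insert_iff empty_iff simp_thms)
    apply (simp_all add: sieved_def)
    done
qed

lemma prime_in_sieve_primes:
  assumes "prime p" "7 \<le> p" "p < 1000"
  shows "p \<in> set sieve_primes"
proof -
  define k where "k = p div 30"
  define r where "r = p mod 30"
  have p: "p = 30 * k + r" by (simp add: k_def r_def)
  have dvd: "\<not> d dvd p" if "1 < d" "d \<noteq> p" for d
    using assms(1) that by (auto simp: prime_nat_iff)
  have "\<not> 2 dvd r" "\<not> 3 dvd r" "\<not> 5 dvd r"
    using dvd[of 2] dvd[of 3] dvd[of 5] assms(2) unfolding r_def by (simp_all add: dvd_mod_iff)
  moreover have "r < 30" by (simp add: r_def)
  ultimately have "r = 1 \<or> r = 7 \<or> r = 11 \<or> r = 13 \<or> r = 17 \<or> r = 19 \<or> r = 23 \<or> r = 29"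
    by presburger
  then have "r \<in> {1, 7, 11, 13, 17, 19, 23, 29}" by simp
  moreover have "k < 34" using assms(3) by (simp add: k_def less_mult_imp_div_less)
  moreover have "sieved p"
    unfolding sieved_def
  proof (intro ballI impI)
    fix d assume "d \<in> {7, 11, 13, 17, 19, 23, 29, 31 :: nat}" and d: "d dvd p"
    then have "1 < d" by auto
    with d dvd show "d = p" by blast
  qed
  ultimately show ?thesis using sieved_cases[of k r] assms(2,3) p by auto
qed

text \<open>The first simplification turns primes into step counts and digit lists, the second runs
  the walks with ground rules. The right-hand side is the outcome of this computation.\<close>

lemma square_weight_1: "(\<Sum>p\<leftarrow>[7]. square_weight p) = 355498530"
  unfolding enum_squares[symmetric]
  by (simp add: squares_def digs.simps[of "numeral k" for k] digs.simps[of "Suc 0"] dv_def del: enum.simps walk.simps,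
      simp only: enum_simps snd_conv)

lemma square_weight_2: "(\<Sum>p\<leftarrow>[11]. square_weight p) = 83358174"
  unfolding enum_squares[symmetric]
  by (simp add: squares_def digs.simps[of "numeral k" for k] digs.simps[of "Suc 0"] dv_def del: enum.simps walk.simps,
      simp only: enum_simps snd_conv)

lemma square_weight_3: "(\<Sum>p\<leftarrow>[13, 17]. square_weight p) = 152270006"
  unfolding enum_squares[symmetric]
  by (simp add: squares_def digs.simps[of "numeral k" for k] digs.simps[of "Suc 0"] dv_def del: enum.simps walk.simps,
      simp only: enum_simps snd_conv)

lemma square_weight_4: "(\<Sum>p\<leftarrow>[19, 23]. square_weight p) = 53254081"
  unfolding enum_squares[symmetric]
  by (simp add: squares_def digs.simps[of "numeral k" for k] digs.simps[of "Suc 0"] dv_def del: enum.simps walk.simps,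
      simp only: enum_simps snd_conv)

lemma square_weight_5: "(\<Sum>p\<leftarrow>primes_4. square_weight p) = 44642762"
  unfolding enum_squares[symmetric] primes_4_def
  by (simp add: squares_def digs.simps[of "numeral k" for k] digs.simps[of "Suc 0"] dv_def del: enum.simps walk.simps,
      simp only: enum_simps snd_conv)

lemma square_weight_6: "(\<Sum>p\<leftarrow>primes_5. square_weight p) = 6658257"
  unfolding enum_squares[symmetric] primes_5_def
  by (simp add: squares_def digs.simps[of "numeral k" for k] digs.simps[of "Suc 0"] dv_def del: enum.simps walk.simps,
      simp only: enum_simps snd_conv)

lemma square_weight_7: "(\<Sum>p\<leftarrow>primes_6. square_weight p) = 1292442"
  unfolding enum_squares[symmetric] primes_6_def
  by (simp add: squares_def digs.simps[of "numeral k" for k] digs.simps[of "Suc 0"] dv_def del: enum.simps walk.simps,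
      simp only: enum_simps snd_conv)

lemma sum_square_weight: "(\<Sum>p\<leftarrow>sieve_primes. square_weight p) = 696974252"
  by (simp add: sieve_primes_def primes_3_def
      square_weight_1[simplified] square_weight_2[simplified]
      square_weight_3[simplified] square_weight_4[simplified]
      square_weight_5 square_weight_6 square_weight_7)

section \<open>The expected length as a series\<close>

fun survives :: "nat \<Rightarrow> nat \<Rightarrow> nat stream \<Rightarrow> bool" where
  "survives n 0 \<omega> \<longleftrightarrow> True"
| "survives n (Suc k) \<omega> \<longleftrightarrow> squarefree (10 * n + shd \<omega>) \<and> survives (10 * n + shd \<omega>) k (stl \<omega>)"

lemma survives_iff:
  "survives n k \<omega> \<longleftrightarrow> (\<forall>i<k. squarefree (foldl (\<lambda>n d. 10 * n + d) n (stake (Suc i) \<omega>)))"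
  by (induction k arbitrary: n \<omega>) (simp_all add: All_less_Suc2)

lemma less_squarefree_walk_length_iff:
  "enat k < squarefree_walk_length 10 \<omega> \<longleftrightarrow> survives 0 k \<omega>"
proof -
  have "enat k < squarefree_walk_length 10 \<omega> \<longleftrightarrow> enat (Suc k) \<le> squarefree_walk_length 10 \<omega>"
    by (simp add: Suc_ile_eq)
  also have "\<dots> \<longleftrightarrow> (\<forall>i. 0 < i \<and> \<not> squarefree (digits_value 10 (stake i \<omega>)) \<longrightarrow> k < i)"
    unfolding squarefree_walk_length_def by (simp add: le_INF_iff Suc_le_eq)
  also have "\<dots> \<longleftrightarrow> survives 0 k \<omega>"
    unfolding survives_iff digits_value_def by (metis gr0_conv_Suc not_less_eq)
  finally show ?thesis .
qed

abbreviation "digit_measure \<equiv> measure_pmf (pmf_of_set {..<10::nat})"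

lemma measurable_survives [measurable]: "Measurable.pred (stream_space digit_measure) (survives n k)"
proof (induction k arbitrary: n)
  case 0
  have "survives n 0 = (\<lambda>_. True)" by (simp add: fun_eq_iff)
  then show ?case by simp
next
  case (Suc k)
  have 1: "Measurable.pred (stream_space digit_measure)
      (\<lambda>\<omega>. squarefree (10 * n + d) \<and> survives (10 * n + d) k (stl \<omega>))" for d
    by (intro pred_intros_logic measurable_compose[OF measurable_stl Suc]) simp
  have 2: "shd \<in> measurable (stream_space digit_measure) (count_space UNIV)"
    using measurable_shd[of digit_measure] by (simp add: measurable_def)
  show ?case
    using measurable_compose_countable[OF 1 2] by simp
qed

text \<open>Conditioning on the first digit; the start \<open>n\<close> is arbitrary in the
  induction because that digit changes it.\<close>

lemma emeasure_survives:
  "emeasure (stream_space digit_measure) {\<omega> \<in> space (stream_space digit_measure). survives n k \<omega>}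
     = ennreal (real (desc squarefree k n) / 10 ^ k)"
proof (induction k arbitrary: n)
  case 0
  interpret prob_space "stream_space digit_measure"
    by (rule prob_space.prob_space_stream_space) (rule prob_space_measure_pmf)
  show ?case by (simp add: emeasure_space_1)
next
  case (Suc k)
  let ?S = "stream_space digit_measure"
  let ?f = "\<lambda>d. if squarefree (10 * n + d) then real (desc squarefree k (10 * n + d)) / 10 ^ k else 0"
  have "emeasure ?S {\<omega> \<in> space ?S. survives n (Suc k) \<omega>}
     = (\<integral>\<^sup>+ d. emeasure ?S {\<omega> \<in> space ?S. d ## \<omega> \<in> {\<omega> \<in> space ?S. survives n (Suc k) \<omega>}} \<partial>digit_measure)"
    by (rule prob_space.emeasure_stream_space) (auto intro: prob_space_measure_pmf)
  also have "\<dots> = (\<integral>\<^sup>+ d. ennreal (?f d) \<partial>digit_measure)"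
  proof (rule nn_integral_cong)
    fix d
    have "{\<omega> \<in> space ?S. d ## \<omega> \<in> {\<omega> \<in> space ?S. survives n (Suc k) \<omega>}}
        = {\<omega> \<in> space ?S. squarefree (10 * n + d) \<and> survives (10 * n + d) k \<omega>}"
      by (auto simp: stream_space_Stream)
    then show "emeasure ?S {\<omega> \<in> space ?S. d ## \<omega> \<in> {\<omega> \<in> space ?S. survives n (Suc k) \<omega>}} = ennreal (?f d)"
      using Suc.IH[of "10 * n + d"] by (cases "squarefree (10 * n + d)") simp_all
  qed
  also have "\<dots> = (\<Sum>d<10. ennreal (?f d)) / 10"
    by (subst nn_integral_pmf_of_set) (auto simp: lessThan_empty_iff)
  also have "\<dots> = ennreal ((\<Sum>d<10. ?f d) / 10)"
    by (subst sum_ennreal) (auto simp: ennreal_divide_numeral sum_nonneg)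
  also have "(\<Sum>d<10. ?f d) / 10 = real (desc squarefree (Suc k) n) / 10 ^ Suc k"
    by (simp add: sum_divide_distrib of_nat_sum if_distrib[of real] if_distrib[of "\<lambda>x. x / _"]
        mult.commute[of "10 ^ k"] cong: if_cong)
  finally show ?case .
qed

text \<open>The expectation of a length is the sum over \<open>k\<close> of the probabilities that
  it exceeds \<open>k\<close>.\<close>

lemma expected_squarefree_walk_length_eq:
  "expected_squarefree_walk_length 10 = (\<Sum>k. ennreal (real (desc squarefree k 0) / 10 ^ k))"
proof -
  let ?S = "stream_space digit_measure"
  have "(\<integral>\<^sup>+ \<omega>. ennreal_of_enat (squarefree_walk_length 10 \<omega>) \<partial>?S)
      = (\<integral>\<^sup>+ \<omega>. (\<Sum>k. indicator {\<omega> \<in> space ?S. survives 0 k \<omega>} \<omega>) \<partial>?S)"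
  proof (rule nn_integral_cong)
    fix \<omega> assume \<omega>: "\<omega> \<in> space ?S"
    let ?L = "squarefree_walk_length 10 \<omega>"
    \<comment> \<open>A length is the number of \<open>k\<close> below it, also when it is
      infinite.\<close>
    have "(\<lambda>k::nat. if k < ?L then 1 else 0) sums ennreal_of_enat ?L"
      using sums_If_finite[of "\<lambda>r. r < ?L" "\<lambda>_. 1 :: ennreal"]
      by (cases ?L) (simp_all add: sums_def of_nat_tendsto_top_ennreal)
    moreover have "(\<lambda>k::nat. if k < ?L then 1 else 0) = (\<lambda>k. indicator {\<omega> \<in> space ?S. survives 0 k \<omega>} \<omega> :: ennreal)"
      using \<omega> by (auto simp: less_squarefree_walk_length_iff fun_eq_iff)
    ultimately show "ennreal_of_enat ?L = (\<Sum>k. indicator {\<omega> \<in> space ?S. survives 0 k \<omega>} \<omega>)"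
      by (simp add: sums_iff)
  qed
  also have "\<dots> = (\<Sum>k. emeasure ?S {\<omega> \<in> space ?S. survives 0 k \<omega>})"
    by (simp add: nn_integral_suminf)
  finally show ?thesis
    unfolding expected_squarefree_walk_length_def random_digits_def emeasure_survives .
qed

section \<open>The lower bound\<close>

abbreviation "loss k m \<equiv> wdesc small_squarefree (10 - Suc k) m"

lemma squarefree_imp_small: "squarefree (m :: nat) \<Longrightarrow> small_squarefree m"
  using squarefreeD[of m 2] squarefreeD[of m 3] squarefreeD[of m 5]
  by (auto simp: small_squarefree_def)

lemma wdesc_small_0: "wdesc small_squarefree j 0 = class_wdesc j D0 D0"
  by (simp add: wdesc_class dv_def)

lemma desc_small_0:
  "desc small_squarefree (numeral k) 0
     = class_wdesc (numeral k) D0 D0 - 10 * class_wdesc (pred_numeral k) D0 D0"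
  using wdesc_Suc_eq[of small_squarefree "pred_numeral k" 0]
  by (simp add: wdesc_small_0 numeral_eq_Suc del: desc.simps wdesc.simps class_wdesc.simps)

lemma desc_small_0_values:
  "desc small_squarefree 0 0 = 1" "desc small_squarefree 1 0 = 6"
  "desc small_squarefree 2 0 = 39" "desc small_squarefree 3 0 = 258"
  "desc small_squarefree 4 0 = 1716" "desc small_squarefree 5 0 = 11384"
  "desc small_squarefree 6 0 = 75561" "desc small_squarefree 7 0 = 501593"
  using wdesc_Suc_eq[of small_squarefree 0 0, folded One_nat_def]
  by (simp_all only: desc_small_0 wdesc_small_0 desc.simps(1) wdesc.simps(1) pred_numeral_simps BitM.simps
      numeral_One class_wdesc_1 class_wdesc_2 class_wdesc_3 class_wdesc_4
      class_wdesc_5 class_wdesc_6 class_wdesc_7) simp_all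

text \<open>Uniform bounds for the loss at strings with 10, 9, 8 and 7 digits, in this
  order.\<close>

lemma wdesc_small_le:
  "wdesc small_squarefree 0 m \<le> 1" "wdesc small_squarefree 1 m \<le> 18"
  "wdesc small_squarefree 2 m \<le> 233" "wdesc small_squarefree 3 m \<le> 2682"
proof -
  have "\<forall>s x. class_wdesc 1 s x \<le> 18" "\<forall>s x. class_wdesc 2 s x \<le> 233" "\<forall>s x. class_wdesc 3 s x \<le> 2682"
    by (simp_all only: dg_all class_wdesc_1 class_wdesc_2 class_wdesc_3) simp_all
  then show "wdesc small_squarefree 1 m \<le> 18" "wdesc small_squarefree 2 m \<le> 233"
    "wdesc small_squarefree 3 m \<le> 2682"
    unfolding wdesc_class by blast+
qed simp

section \<open>Covering the killed strings by multiples of squares\<close>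

lemma sum_cover_le:
  fixes w :: "nat \<Rightarrow> nat"
  assumes "finite K"
  shows "(\<Sum>m | m \<in> K \<and> (\<exists>p\<in>set ps. P p m). w m) \<le> (\<Sum>p\<leftarrow>ps. \<Sum>m | m \<in> K \<and> P p m. w m)"
proof (induction ps)
  case (Cons p ps)
  have "{m. m \<in> K \<and> (\<exists>q\<in>set (p # ps). P q m)}
      = {m. m \<in> K \<and> P p m} \<union> {m. m \<in> K \<and> (\<exists>q\<in>set ps. P q m)}" by auto
  then have "(\<Sum>m | m \<in> K \<and> (\<exists>q\<in>set (p # ps). P q m). w m)
      \<le> (\<Sum>m | m \<in> K \<and> P p m. w m) + (\<Sum>m | m \<in> K \<and> (\<exists>q\<in>set ps. P q m). w m)"
    using assms by (simp add: sum_Un_nat)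
  then show ?case using Cons by simp
qed simp

definition big_square_multiples :: "nat \<Rightarrow> nat set" where
  "big_square_multiples k = {m \<in> chain small_squarefree k. \<exists>n. odd n \<and> 1001 \<le> n \<and> n\<^sup>2 dvd m}"

lemma finite_big_square_multiples [simp]: "finite (big_square_multiples k)"
  unfolding big_square_multiples_def by (rule finite_subset[OF _ finite_chain]) blast

lemma small_not_4_dvd: "small_squarefree m \<Longrightarrow> \<not> 4 dvd m"
  by (simp add: small_squarefree_def)

lemma chain_small_pos: "m \<in> chain small_squarefree (Suc k) \<Longrightarrow> 0 < m"
  by (rule gr0I) (auto simp: small_squarefree_def)

text \<open>A killed number is divisible by the square of a prime, and the tests exclude 2, 3 and 5.
  A prime below 1000 is listed; of a larger one only oddness and size are kept.\<close>

lemma killed_cases: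
  assumes "m \<in> killed squarefree small_squarefree k"
  shows "(\<exists>p\<in>set sieve_primes. p\<^sup>2 dvd m) \<or> m \<in> big_square_multiples (Suc k)"
proof -
  have ch: "m \<in> chain small_squarefree (Suc k)"
    using assms killed_subset_chain[of squarefree small_squarefree] squarefree_imp_small by blast
  have m: "m > 0" "\<not> squarefree m" "small_squarefree m"
    using assms chain_small_pos[OF ch] by (auto simp: killed_def)
  then obtain p where p: "prime p" "p\<^sup>2 dvd m"
    using squarefree_factorial_semiring[of m] by auto
  have p_gt: "p > 1" using p(1) by (rule prime_gt_1_nat)
  have "p \<noteq> 2" "p \<noteq> 3" "p \<noteq> 5"
    using p(2) m(3) by (auto simp: small_squarefree_def)
  moreover have "p \<noteq> 4" "p \<noteq> 6"
    using p(1) by (auto simp: prime_nat_iff dest: spec[of _ 2])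
  ultimately have "7 \<le> p" using p_gt by linarith
  show ?thesis
  proof (cases "p < 1000")
    case True
    then show ?thesis using prime_in_sieve_primes[OF p(1) \<open>7 \<le> p\<close>] p(2) by blast
  next
    case False
    moreover have "odd p" using p(1) \<open>7 \<le> p\<close> prime_odd_nat by auto
    ultimately have "1001 \<le> p" by (cases "p = 1000") auto
    then show ?thesis using ch p(2) \<open>odd p\<close> by (auto simp: big_square_multiples_def simp del: chain.simps)
  qed
qed

lemma sum_killed_le:
  "(\<Sum>m\<in>killed squarefree small_squarefree k. w m)
     \<le> (\<Sum>p\<leftarrow>sieve_primes. \<Sum>m | m \<in> killed squarefree small_squarefree k \<and> p\<^sup>2 dvd m. w m)
       + (\<Sum>m\<in>big_square_multiples (Suc k). w m :: nat)"
proof -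
  let ?K = "killed squarefree small_squarefree k"
  have "?K \<subseteq> {m. m \<in> ?K \<and> (\<exists>p\<in>set sieve_primes. p\<^sup>2 dvd m)} \<union> big_square_multiples (Suc k)"
    using killed_cases by blast
  then have "(\<Sum>m\<in>?K. w m)
      \<le> (\<Sum>m\<in>{m. m \<in> ?K \<and> (\<exists>p\<in>set sieve_primes. p\<^sup>2 dvd m)} \<union> big_square_multiples (Suc k). w m)"
    by (intro sum_mono2) auto
  also have "\<dots> \<le> (\<Sum>m | m \<in> ?K \<and> (\<exists>p\<in>set sieve_primes. p\<^sup>2 dvd m). w m)
      + (\<Sum>m\<in>big_square_multiples (Suc k). w m)"
    by (subst sum_Un_nat) auto
  finally show ?thesis
    using sum_cover_le[of ?K w sieve_primes "\<lambda>p m. p\<^sup>2 dvd m"] by simp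
qed

text \<open>The \<open>killed\<close> sets are disjoint because their members differ in the number
  of digits. Up to seven digits, all their multiples of \<open>p\<^sup>2\<close> are among the
  positive ones below \<open>10 ^ 7\<close>.\<close>

lemma sum_killed_multiples_le_square_weight:
  assumes "p > 0"
  shows "(\<Sum>k<7. \<Sum>m | m \<in> killed squarefree small_squarefree k \<and> p\<^sup>2 dvd m. loss k m) \<le> square_weight p"
proof -
  let ?A = "\<lambda>k. {m. m \<in> killed squarefree small_squarefree k \<and> p\<^sup>2 dvd m}"
  have weight: "weight (digs m) = loss k m" "length (digs m) = Suc k"
    if "m \<in> killed squarefree small_squarefree k" for m k
    using weight_killed[OF that] squarefree_imp_small by blast+
  have "(\<Sum>k<7. \<Sum>m\<in>?A k. loss k m) = (\<Sum>k<7. \<Sum>m\<in>?A k. weight (digs m))"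
    by (intro sum.cong refl) (auto simp: weight)
  also have "\<dots> = (\<Sum>m\<in>(\<Union>k<7. ?A k). weight (digs m))"
  proof (rule sum.UNION_disjoint[symmetric])
    show "\<forall>i\<in>{..<7}. \<forall>j\<in>{..<7}. i \<noteq> j \<longrightarrow> ?A i \<inter> ?A j = {}"
      by (auto dest!: weight(2))
  qed auto
  also have "\<dots> \<le> (\<Sum>m\<in>(\<lambda>i. i * p\<^sup>2) ` {1..(10 ^ 7 - 1) div p\<^sup>2}. weight (digs m))"
  proof (rule sum_mono2)
    show "(\<Union>k<7. ?A k) \<subseteq> (\<lambda>i. i * p\<^sup>2) ` {1..(10 ^ 7 - 1) div p\<^sup>2}"
    proof safe
      fix k m assume k: "k < (7::nat)" and m: "m \<in> killed squarefree small_squarefree k" "p\<^sup>2 dvd m"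
      have ch: "m \<in> chain small_squarefree (Suc k)"
        using m killed_subset_chain[of squarefree small_squarefree] squarefree_imp_small by blast
      obtain i where "m = p\<^sup>2 * i" using m(2) by (rule dvdE)
      then have i: "m = i * p\<^sup>2" by (simp add: mult.commute)
      have "(10::nat) ^ Suc k \<le> 10 ^ 7" using k by (intro power_increasing) auto
      then have "m \<le> 10 ^ 7 - 1" using chain_less[OF ch] by linarith
      then have "i \<le> (10 ^ 7 - 1) div p\<^sup>2"
        using i assms by (simp add: less_eq_div_iff_mult_less_eq)
      moreover have "i \<ge> 1" using i chain_small_pos[OF ch] by (cases i) auto
      ultimately show "m \<in> (\<lambda>i. i * p\<^sup>2) ` {1..(10 ^ 7 - 1) div p\<^sup>2}" using i by auto
    qed
  qed auto
  also have "\<dots> = square_weight p"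
    unfolding square_weight_def using assms by (subst sum.reindex) (auto simp: inj_on_def)
  finally show ?thesis .
qed

lemma card_killed_multiples_le:
  assumes "s \<le> Suc k" "p > 0"
  shows "card {m. m \<in> killed squarefree small_squarefree k \<and> p\<^sup>2 dvd m}
    \<le> desc small_squarefree (Suc k - s) 0 * (let t = (10 ^ s + p\<^sup>2 - 1) div p\<^sup>2 in t - t div 4)"
proof -
  have "card {m. m \<in> killed squarefree small_squarefree k \<and> p\<^sup>2 dvd m}
      \<le> card {m \<in> chain small_squarefree (Suc k). p\<^sup>2 dvd m}"
    using killed_subset_chain[of squarefree small_squarefree k, OF squarefree_imp_small]
    by (intro card_mono) (auto simp del: chain.simps)
  also have "\<dots> \<le> desc small_squarefree (Suc k - s) 0 * (let t = (10 ^ s + p\<^sup>2 - 1) div p\<^sup>2 in t - t div 4)"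
    unfolding Let_def using assms by (intro card_chain_multiples small_not_4_dvd) auto
  finally show ?thesis .
qed

definition ceiling_count :: "nat \<Rightarrow> nat \<Rightarrow> nat" where
  "ceiling_count s p = (let t = (10 ^ s + p\<^sup>2 - 1) div p\<^sup>2 in t - t div 4)"

lemma sum_ceiling_count:
  "(\<Sum>p\<leftarrow>primes_3. ceiling_count 3 p) = 36"
  "(\<Sum>p\<leftarrow>primes_4. ceiling_count 4 p) = 54"
  "(\<Sum>p\<leftarrow>primes_5. ceiling_count 5 p) = 140"
  "(\<Sum>p\<leftarrow>primes_6. ceiling_count 6 p) = 572"
  unfolding primes_3_def primes_4_def primes_5_def primes_6_def
  by (simp_all add: ceiling_count_def)

lemma sum_killed_multiples_le:
  assumes "6 \<le> Suc k" "\<And>m. loss k m \<le> c" "0 \<notin> set ps" "s \<le> 6"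
  shows "(\<Sum>p\<leftarrow>ps. \<Sum>m | m \<in> killed squarefree small_squarefree k \<and> p\<^sup>2 dvd m. loss k m)
    \<le> desc small_squarefree (Suc k - s) 0 * (\<Sum>p\<leftarrow>ps. ceiling_count s p) * c"
  using assms(3)
proof (induction ps)
  case (Cons p ps)
  let ?A = "{m. m \<in> killed squarefree small_squarefree k \<and> p\<^sup>2 dvd m}"
  have "(\<Sum>m\<in>?A. loss k m) \<le> card ?A * c"
    using sum_bounded_above[of ?A "loss k" c] assms(2) by simp
  also have "\<dots> \<le> desc small_squarefree (Suc k - s) 0 * ceiling_count s p * c"
    unfolding ceiling_count_def using assms Cons.prems by (intro mult_right_mono card_killed_multiples_le) auto
  finally show ?case using Cons by (simp add: algebra_simps)
qed simp

text \<open>The block length \<open>10 ^ s\<close> grows with the primes so that it exceeds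
  \<open>p\<^sup>2\<close>; the prefixes have \<open>Suc k - s\<close> digits, hence
  \<open>k - 2\<close> for \<open>s = 3\<close>, and so on.\<close>

lemma sum_killed_sieve_le:
  assumes "6 \<le> Suc k" "\<And>m. loss k m \<le> c"
  shows "(\<Sum>p\<leftarrow>sieve_primes. \<Sum>m | m \<in> killed squarefree small_squarefree k \<and> p\<^sup>2 dvd m. loss k m)
    \<le> (desc small_squarefree (k - 2) 0 * 36 + desc small_squarefree (k - 3) 0 * 54
       + desc small_squarefree (k - 4) 0 * 140 + desc small_squarefree (k - 5) 0 * 572) * c"
proof -
  have "0 \<notin> set primes_3" "0 \<notin> set primes_4" "0 \<notin> set primes_5" "0 \<notin> set primes_6"
    unfolding primes_3_def primes_4_def primes_5_def primes_6_def by simp_all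
  note le = this[THEN sum_killed_multiples_le[OF assms]]
  have "Suc k - 3 = k - 2" "Suc k - 4 = k - 3" "Suc k - 5 = k - 4" "Suc k - 6 = k - 5"
    by simp_all
  then show ?thesis
    using le(1)[of 3] le(2)[of 4] le(3)[of 5] le(4)[of 6]
    unfolding sieve_primes_def map_append sum_list_append sum_ceiling_count add_mult_distrib by simp
qed

section \<open>Multiples of squares of odd numbers above 1000\<close>

definition odd_square_multiples :: "nat \<Rightarrow> nat \<Rightarrow> nat \<Rightarrow> nat set" where
  "odd_square_multiples k a N = {m \<in> chain small_squarefree k. \<exists>i<N. (a + 2 * i)\<^sup>2 dvd m}"

text \<open>A cardinality is an integer, so a real estimate strictly below \<open>c + 1\<close>
  suffices.\<close>

lemma card_odd_square_multiples_le:
  assumes "s \<le> k" "k > 0" "a > 1"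
    and "real (desc small_squarefree (k - s) 0)
      * (10 ^ s * ((1 / (real a - 1) - 1 / (real a + 2 * real N - 1)) / 2) + real N) < real c + 1"
  shows "card (odd_square_multiples k a N) \<le> c"
proof -
  have "real (card (odd_square_multiples k a N)) < real c + 1"
    unfolding odd_square_multiples_def
    using card_chain_odd_square_multiples[where Q = small_squarefree and N = N,
        OF small_not_4_dvd assms(1-3)] assms(4) by linarith
  then show ?thesis by linarith
qed

lemma big_square_multiples_cases:
  assumes "m \<in> big_square_multiples k" "10 ^ k \<le> b\<^sup>2" "k > 0"
  obtains n where "odd n" "1001 \<le> n" "n < b" "n\<^sup>2 dvd m" "m \<in> chain small_squarefree k"
proof -
  obtain n where n: "odd n" "1001 \<le> n" "n\<^sup>2 dvd m" "m \<in> chain small_squarefree k"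
    using assms(1) by (auto simp: big_square_multiples_def)
  have "m > 0" using n(4) assms(3) chain_small_pos by (cases k) auto
  then have "n\<^sup>2 \<le> m" using n(3) by (simp add: dvd_imp_le)
  also have "m < b\<^sup>2" using chain_less[OF n(4)] assms(2) by linarith
  finally have "n < b" by (rule power_less_imp_less_base) simp
  then show ?thesis using n that by blast
qed

lemma odd_square_multiplesI:
  assumes "odd n" "odd a" "a \<le> n" "n < a + 2 * N" "n\<^sup>2 dvd m" "m \<in> chain small_squarefree k"
  shows "m \<in> odd_square_multiples k a N"
proof -
  have "n = a + 2 * ((n - a) div 2)" using assms(1-3) by simp
  moreover have "(n - a) div 2 < N" using assms(3,4) by linarith
  ultimately show ?thesis using assms(5,6) unfolding odd_square_multiples_def by force
qed

lemma big_square_multiples_empty: "k \<le> 6 \<Longrightarrow> k > 0 \<Longrightarrow> big_square_multiples k = {}"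
proof -
  assume k: "k \<le> 6" "k > 0"
  have "(10::nat) ^ k \<le> 10 ^ 6" using k by (intro power_increasing) auto
  then have le: "(10::nat) ^ k \<le> 1000\<^sup>2" by simp
  have False if "m \<in> big_square_multiples k" for m
    using that le k(2) by (rule big_square_multiples_cases) linarith
  then show ?thesis by blast
qed

text \<open>Here \<open>3163\<^sup>2 > 10 ^ 7\<close> and \<open>1001 + 2 * 1081 = 3163\<close>.
  With \<open>s = k\<close>, all strings form a single block.\<close>

lemma card_big_square_multiples_7: "card (big_square_multiples 7) \<le> 4499"
proof -
  have "m \<in> odd_square_multiples 7 1001 1081" if m: "m \<in> big_square_multiples 7" for m
  proof -
    obtain n where n: "odd n" "1001 \<le> n" "n < 3163" "n\<^sup>2 dvd m" "m \<in> chain small_squarefree 7"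
      using big_square_multiples_cases[OF m, of 3163] by auto
    then show ?thesis by (auto intro!: odd_square_multiplesI[OF n(1) _ _ _ n(4,5)])
  qed
  then have "big_square_multiples 7 \<subseteq> odd_square_multiples 7 1001 1081" by blast
  then have "card (big_square_multiples 7) \<le> card (odd_square_multiples 7 1001 1081)"
    by (rule card_mono[rotated]) (simp add: odd_square_multiples_def)
  also have "card (odd_square_multiples 7 1001 1081) \<le> 4499"
    by (rule card_odd_square_multiples_le[of 7]) (simp_all add: desc_small_0_values
        desc_small_0_values(2)[unfolded One_nat_def] del: desc.simps(2))
  finally show ?thesis by simp
qed

text \<open>Here and in the next two lemmas the range of \<open>n\<close> is cut near square roots
  of powers of 10, and in each part \<open>10 ^ s\<close> is about the largest square that occurs.
  This balances the rounding term \<open>N\<close> against the main term.\<close>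

lemma card_big_square_multiples_8: "card (big_square_multiples 8) \<le> 41250"
proof -
  have "m \<in> odd_square_multiples 8 1001 1100 \<union> odd_square_multiples 8 3201 3400" if m: "m \<in> big_square_multiples 8" for m
  proof -
    obtain n where n: "odd n" "1001 \<le> n" "n < 10001" "n\<^sup>2 dvd m" "m \<in> chain small_squarefree 8"
      using big_square_multiples_cases[OF m, of 10001] by auto
    consider "n < 3201" | "3201 \<le> n" by linarith
    then show ?thesis
      using n by cases (auto intro!: odd_square_multiplesI[OF n(1) _ _ _ n(4,5)])
  qed
  then have "big_square_multiples 8 \<subseteq> odd_square_multiples 8 1001 1100 \<union> odd_square_multiples 8 3201 3400" by blast
  then have "card (big_square_multiples 8) \<le> card (odd_square_multiples 8 1001 1100 \<union> odd_square_multiples 8 3201 3400)"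
    by (rule card_mono[rotated]) (simp add: odd_square_multiples_def)
  also have "\<dots> \<le> card (odd_square_multiples 8 1001 1100) + card (odd_square_multiples 8 3201 3400)"
    by (intro order_trans[OF card_Un_le] add_mono order_refl)
  also have "card (odd_square_multiples 8 1001 1100) \<le> 27225"
    by (rule card_odd_square_multiples_le[of 7]) (simp_all add: desc_small_0_values
        desc_small_0_values(2)[unfolded One_nat_def] del: desc.simps(2))
  also have "card (odd_square_multiples 8 3201 3400) \<le> 14025"
    by (rule card_odd_square_multiples_le[of 8]) (simp_all add: desc_small_0_values
        desc_small_0_values(2)[unfolded One_nat_def] del: desc.simps(2))
  finally show ?thesis by simp
qed

lemma card_big_square_multiples_9: "card (big_square_multiples 9) \<le> 306111"
proof -
  have "m \<in> odd_square_multiples 9 1001 1100 \<union> odd_square_multiples 9 3201 3400 \<union> odd_square_multiples 9 10001 10811" if m: "m \<in> big_square_multiples 9" for m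
  proof -
    obtain n where n: "odd n" "1001 \<le> n" "n < 31623" "n\<^sup>2 dvd m" "m \<in> chain small_squarefree 9"
      using big_square_multiples_cases[OF m, of 31623] by auto
    consider "n < 3201" | "3201 \<le> n" "n < 10001" | "10001 \<le> n" by linarith
    then show ?thesis
      using n by cases (auto intro!: odd_square_multiplesI[OF n(1) _ _ _ n(4,5)])
  qed
  then have "big_square_multiples 9 \<subseteq> odd_square_multiples 9 1001 1100 \<union> odd_square_multiples 9 3201 3400 \<union> odd_square_multiples 9 10001 10811" by blast
  then have "card (big_square_multiples 9) \<le> card (odd_square_multiples 9 1001 1100 \<union> odd_square_multiples 9 3201 3400 \<union> odd_square_multiples 9 10001 10811)"
    by (rule card_mono[rotated]) (simp add: odd_square_multiples_def)
  also have "\<dots> \<le> card (odd_square_multiples 9 1001 1100) + card (odd_square_multiples 9 3201 3400) + card (odd_square_multiples 9 10001 10811)"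
    by (intro order_trans[OF card_Un_le] add_mono order_refl)
  also have "card (odd_square_multiples 9 1001 1100) \<le> 176962"
    by (rule card_odd_square_multiples_le[of 7]) (simp_all add: desc_small_0_values
        desc_small_0_values(2)[unfolded One_nat_def] del: desc.simps(2))
  also have "card (odd_square_multiples 9 3201 3400) \<le> 84150"
    by (rule card_odd_square_multiples_le[of 8]) (simp_all add: desc_small_0_values
        desc_small_0_values(2)[unfolded One_nat_def] del: desc.simps(2))
  also have "card (odd_square_multiples 9 10001 10811) \<le> 44999"
    by (rule card_odd_square_multiples_le[of 9]) (simp_all add: desc_small_0_values
        desc_small_0_values(2)[unfolded One_nat_def] del: desc.simps(2))
  finally show ?thesis by simp
qed

lemma card_big_square_multiples_10: "card (big_square_multiples 10) \<le> 2130150"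
proof -
  have "m \<in> odd_square_multiples 10 1001 1100 \<union> odd_square_multiples 10 3201 3400 \<union> odd_square_multiples 10 10001 11000 \<union> odd_square_multiples 10 32001 34000" if m: "m \<in> big_square_multiples 10" for m
  proof -
    obtain n where n: "odd n" "1001 \<le> n" "n < 100001" "n\<^sup>2 dvd m" "m \<in> chain small_squarefree 10"
      using big_square_multiples_cases[OF m, of 100001] by auto
    consider "n < 3201" | "3201 \<le> n" "n < 10001" | "10001 \<le> n" "n < 32001" | "32001 \<le> n" by linarith
    then show ?thesis
      using n by cases (auto intro!: odd_square_multiplesI[OF n(1) _ _ _ n(4,5)])
  qed
  then have "big_square_multiples 10 \<subseteq> odd_square_multiples 10 1001 1100 \<union> odd_square_multiples 10 3201 3400 \<union> odd_square_multiples 10 10001 11000 \<union> odd_square_multiples 10 32001 34000" by blast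
  then have "card (big_square_multiples 10) \<le> card (odd_square_multiples 10 1001 1100 \<union> odd_square_multiples 10 3201 3400 \<union> odd_square_multiples 10 10001 11000 \<union> odd_square_multiples 10 32001 34000)"
    by (rule card_mono[rotated]) (simp add: odd_square_multiples_def)
  also have "\<dots> \<le> card (odd_square_multiples 10 1001 1100) + card (odd_square_multiples 10 3201 3400) + card (odd_square_multiples 10 10001 11000) + card (odd_square_multiples 10 32001 34000)"
    by (intro order_trans[OF card_Un_le] add_mono order_refl)
  also have "card (odd_square_multiples 10 1001 1100) \<le> 1170675"
    by (rule card_odd_square_multiples_le[of 7]) (simp_all add: desc_small_0_values
        desc_small_0_values(2)[unfolded One_nat_def] del: desc.simps(2))
  also have "card (odd_square_multiples 10 3201 3400) \<le> 546975"
    by (rule card_odd_square_multiples_le[of 8]) (simp_all add: desc_small_0_values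
        desc_small_0_values(2)[unfolded One_nat_def] del: desc.simps(2))
  also have "card (odd_square_multiples 10 10001 11000) \<le> 272250"
    by (rule card_odd_square_multiples_le[of 9]) (simp_all add: desc_small_0_values
        desc_small_0_values(2)[unfolded One_nat_def] del: desc.simps(2))
  also have "card (odd_square_multiples 10 32001 34000) \<le> 140250"
    by (rule card_odd_square_multiples_le[of 10]) (simp_all add: desc_small_0_values
        desc_small_0_values(2)[unfolded One_nat_def] del: desc.simps(2))
  finally show ?thesis by simp
qed

lemma sum_sum_list_swap:
  "(\<Sum>k\<in>A. \<Sum>p\<leftarrow>ps. f k p) = (\<Sum>p\<leftarrow>ps. \<Sum>k\<in>A. f k p :: nat)"
  by (induction ps) (simp_all add: sum.distrib)

text \<open>The constant is the enumerated weight 696974252 plus \<open>4499 * 2682\<close> for the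
  squares of numbers above 1000, which only strings of seven digits can contain.\<close>

lemma sum_killed_low_le:
  "(\<Sum>k<7. \<Sum>m\<in>killed squarefree small_squarefree k. loss k m) \<le> 709040570"
proof -
  define A where "A k p = (\<Sum>m | m \<in> killed squarefree small_squarefree k \<and> p\<^sup>2 dvd m. loss k m)" for k p
  define B where "B k = (\<Sum>m\<in>big_square_multiples (Suc k). loss k m)" for k
  have "(\<Sum>k<7. \<Sum>m\<in>killed squarefree small_squarefree k. loss k m)
      \<le> (\<Sum>k<7. (\<Sum>p\<leftarrow>sieve_primes. A k p) + B k)"
    unfolding A_def B_def by (intro sum_mono sum_killed_le)
  also have "\<dots> = (\<Sum>p\<leftarrow>sieve_primes. \<Sum>k<7. A k p) + (\<Sum>k<7. B k)"
    by (simp only: sum.distrib sum_sum_list_swap)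
  also have "(\<Sum>p\<leftarrow>sieve_primes. \<Sum>k<7. A k p) \<le> (\<Sum>p\<leftarrow>sieve_primes. square_weight p)"
    unfolding A_def
  proof (intro sum_list_mono sum_killed_multiples_le_square_weight)
    fix p assume "p \<in> set sieve_primes"
    moreover have "0 \<notin> set sieve_primes"
      unfolding sieve_primes_def primes_3_def primes_4_def primes_5_def primes_6_def by simp
    ultimately show "p > 0" by (metis gr0I)
  qed
  also have "(\<Sum>k<7. B k) = B 6"
  proof -
    have "B k = 0" if "k < 6" for k
      using that by (simp add: B_def big_square_multiples_empty)
    then have "(\<Sum>k<6. B k) = 0" by simp
    then show ?thesis using sum.lessThan_Suc[of B 6] by simp
  qed
  also have "B 6 \<le> card (big_square_multiples 7) * 2682"
    unfolding B_def using sum_bounded_above[of "big_square_multiples 7" "loss 6" 2682] wdesc_small_le(4)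
    by (simp del: wdesc.simps)
  also have "\<dots> \<le> 4499 * 2682"
    by (intro mult_right_mono card_big_square_multiples_7) simp
  finally show ?thesis by (simp add: sum_square_weight)
qed

lemma sum_killed_high_le:
  assumes "6 \<le> Suc k" "\<And>m. loss k m \<le> c" "card (big_square_multiples (Suc k)) \<le> b"
  shows "(\<Sum>m\<in>killed squarefree small_squarefree k. loss k m)
    \<le> (desc small_squarefree (k - 2) 0 * 36 + desc small_squarefree (k - 3) 0 * 54
       + desc small_squarefree (k - 4) 0 * 140 + desc small_squarefree (k - 5) 0 * 572 + b) * c"
proof -
  have "(\<Sum>m\<in>big_square_multiples (Suc k). loss k m) \<le> card (big_square_multiples (Suc k)) * c"
    using sum_bounded_above[of "big_square_multiples (Suc k)" "loss k" c] assms(2) by simp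
  also have "\<dots> \<le> b * c" by (intro mult_right_mono assms) simp
  finally show ?thesis
    using sum_killed_le[where w = "loss k" and k = k] sum_killed_sieve_le[OF assms(1,2)]
    unfolding add_mult_distrib by linarith
qed

text \<open>All numbers are scaled by \<open>10 ^ 10\<close>. From the exact value 27292211773 for
  the moduli 4, 9 and 25, the losses at strings with at most 7 and with 8, 9 and 10 digits are
  subtracted.\<close>

lemma wdesc_squarefree_ge: "26329747900 \<le> wdesc squarefree 10 0"
proof -
  define L where "L k = (\<Sum>m\<in>killed squarefree small_squarefree k. loss k m)" for k
  have loss: "loss 7 m \<le> 233" "loss 8 m \<le> 18" "loss 9 m \<le> 1" for m
    using wdesc_small_le[of m] by (simp_all del: wdesc.simps)
  have "L 7 \<le> 140304678"
    using sum_killed_high_le[of 7 233 41250, OF _ loss(1)] card_big_square_multiples_8 unfolding L_def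
    by (simp add: desc_small_0_values del: wdesc.simps desc.simps(2))
  moreover have "L 8 \<le> 72519462"
    using sum_killed_high_le[of 8 18 306111, OF _ loss(2)] card_big_square_multiples_9 unfolding L_def
    by (simp add: desc_small_0_values del: wdesc.simps desc.simps(2))
  moreover have "L 9 \<le> 26843104"
    using sum_killed_high_le[of 9 1 2130150, OF _ loss(3)] card_big_square_multiples_10 unfolding L_def
    by (simp add: desc_small_0_values del: wdesc.simps desc.simps(2))
  moreover have "(\<Sum>k<7. L k) \<le> 709040570"
    unfolding L_def by (rule sum_killed_low_le)
  moreover have "wdesc squarefree 10 0 + (\<Sum>k<10. L k) = 27292211773"
    using wdesc_killed[of squarefree small_squarefree 10, OF squarefree_imp_small]
    by (simp add: L_def wdesc_small_0 class_wdesc_10 del: wdesc.simps)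
  moreover have "(\<Sum>k<10. L k) = (\<Sum>k<7. L k) + L 7 + L 8 + L 9"
    by (simp add: eval_nat_numeral)
  ultimately show ?thesis by linarith
qed

section \<open>The upper bound\<close>

text \<open>Each non-squarefree number is listed together with the root of a square dividing it.\<close>

definition excluded_3 :: "(nat \<times> nat) list" where
  "excluded_3 = [(7, 147), (7, 294), (13, 338), (7, 343), (7, 539), (17, 578), (7, 735)]"

definition excluded_4 :: "(nat \<times> nat) list" where
  "excluded_4 =
    [(13, 1014), (7, 1029), (23, 1058), (7, 1078), (13, 1183), (11, 1331), (7, 1421),
     (7, 1519), (11, 1573), (23, 1587), (17, 1734), (7, 1911), (7, 2107), (13, 2197),
     (11, 2299), (7, 2303), (11, 2662), (7, 2695), (7, 2989), (7, 3038), (11, 3146),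
     (23, 3174), (17, 3179), (7, 3185), (7, 3479), (13, 3549), (7, 3577), (23, 3703),
     (13, 3718), (7, 3773), (7, 3822), (19, 3971), (11, 3993), (7, 5145), (7, 5194),
     (7, 5341), (7, 5537), (43, 5547), (13, 5577), (13, 5746), (23, 5819), (7, 5831),
     (13, 5915), (7, 5978), (19, 6137), (11, 6171), (7, 6223), (7, 6517), (13, 6591),
     (47, 6627), (11, 6655), (7, 6713), (7, 6909), (7, 6958), (11, 7018), (13, 7098),
     (7, 7105), (11, 7139), (7, 7154), (7, 7301), (7, 7399), (13, 7774), (7, 7791),
     (11, 7865), (23, 7935), (19, 7942), (13, 7943), (11, 7986), (7, 7987)]"

text \<open>Lies between \<open>squarefree\<close> and \<open>small_squarefree\<close>. It rejects
  only finitely many numbers more than the latter, all listed, so a lower bound for its killed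
  weight can be computed.\<close>

definition nearly_squarefree :: "nat \<Rightarrow> bool" where
  "nearly_squarefree m \<longleftrightarrow> small_squarefree m \<and> m \<notin> snd ` set excluded_3 \<and> m \<notin> snd ` set excluded_4"

lemma squarefree_imp_nearly_squarefree:
  assumes "squarefree (m :: nat)"
  shows "nearly_squarefree m"
proof -
  have "\<forall>(d, n)\<in>set excluded_3 \<union> set excluded_4. d\<^sup>2 dvd n \<and> d \<noteq> 1"
    by (simp add: excluded_3_def excluded_4_def)
  then have not_squarefree: "\<not> squarefree n" if "(d, n) \<in> set excluded_3 \<union> set excluded_4" for d n
    using that by (auto simp: squarefree_def)
  have "m \<notin> snd ` set excluded_3" "m \<notin> snd ` set excluded_4"
    using not_squarefree[of _ m] assms by force+
  then show ?thesis
    using squarefree_imp_small[OF assms] by (simp add: nearly_squarefree_def)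
qed

lemma nearly_squarefree_small:
  "m < 1000 \<Longrightarrow> nearly_squarefree m \<longleftrightarrow> small_squarefree m \<and> m \<notin> snd ` set excluded_3"
  "m < 100 \<Longrightarrow> nearly_squarefree m \<longleftrightarrow> small_squarefree m"
proof -
  have "\<forall>(d, n)\<in>set excluded_3. 100 \<le> n" "\<forall>(d, n)\<in>set excluded_4. 1000 \<le> n"
    by (simp_all add: excluded_3_def excluded_4_def)
  then show "m < 1000 \<Longrightarrow> nearly_squarefree m \<longleftrightarrow> small_squarefree m \<and> m \<notin> snd ` set excluded_3"
    "m < 100 \<Longrightarrow> nearly_squarefree m \<longleftrightarrow> small_squarefree m"
    unfolding nearly_squarefree_def by fastforce+
qed

text \<open>The proper prefixes of a listed number survive, so its weight is lost in full.\<close>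

lemma excluded_3_killed:
  "snd ` set excluded_3 \<subseteq> killed nearly_squarefree small_squarefree 2"
proof safe
  fix d m assume m: "(d, m) \<in> set excluded_3"
  have "\<forall>(d, m)\<in>set excluded_3. m < 1000 \<and> small_squarefree m \<and> small_squarefree (m div 10)
      \<and> small_squarefree (m div 10 div 10)"
    by (simp add: excluded_3_def small_squarefree_def)
  with m have s: "m < 1000" "small_squarefree m" "small_squarefree (m div 10)"
      "small_squarefree (m div 10 div 10)"
    by auto
  moreover from this have "nearly_squarefree (m div 10)" "nearly_squarefree (m div 10 div 10)"
    by (simp_all add: nearly_squarefree_small(2))
  moreover have "m div 10 div 10 div 10 = 0" using s(1) by simp
  moreover have "\<not> nearly_squarefree m" using m by (force simp: nearly_squarefree_def)
  ultimately show "snd (d, m) \<in> killed nearly_squarefree small_squarefree 2"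
    by (simp add: killed_def numeral_2_eq_2)
qed

text \<open>The prefixes of three digits avoid \<open>excluded_3\<close>, so no string is charged
  twice.\<close>

lemma excluded_4_killed:
  "snd ` set excluded_4 \<subseteq> killed nearly_squarefree small_squarefree 3"
proof safe
  fix d m assume m: "(d, m) \<in> set excluded_4"
  have "\<forall>(d, m)\<in>set excluded_4. m < 10000 \<and> small_squarefree m \<and> small_squarefree (m div 10)
      \<and> small_squarefree (m div 10 div 10) \<and> small_squarefree (m div 10 div 10 div 10)
      \<and> m div 10 \<notin> snd ` set excluded_3"
    by (simp add: excluded_3_def excluded_4_def small_squarefree_def)
  with m have s: "m < 10000" "small_squarefree m" "small_squarefree (m div 10)"
      "small_squarefree (m div 10 div 10)" "small_squarefree (m div 10 div 10 div 10)"
      "m div 10 \<notin> snd ` set excluded_3"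
    by auto
  moreover from this have "nearly_squarefree (m div 10)"
    by (simp add: nearly_squarefree_small(1))
  moreover have "nearly_squarefree (m div 10 div 10)" "nearly_squarefree (m div 10 div 10 div 10)"
    using s by (simp_all add: nearly_squarefree_small(2))
  moreover have "m div 10 div 10 div 10 div 10 = 0" using s(1) by simp
  moreover have "\<not> nearly_squarefree m" using m by (force simp: nearly_squarefree_def)
  ultimately show "snd (d, m) \<in> killed nearly_squarefree small_squarefree 3"
    by (simp add: killed_def numeral_3_eq_3)
qed

text \<open>The walk is cut at 13 digits: 10 remain after three digits and 9 after four.\<close>

lemma sum_excluded:
  "(\<Sum>m\<in>snd ` set excluded_3. wdesc small_squarefree 10 m) = 204353655514"
  "(\<Sum>m\<in>snd ` set excluded_4. wdesc small_squarefree 9 m) = 201952920108"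
proof -
  have "(\<Sum>m\<in>snd ` set excluded_3. wdesc small_squarefree 10 m)
      = (\<Sum>m\<leftarrow>map snd excluded_3. wdesc small_squarefree 10 m)"
    by (subst sum_list_distinct_conv_sum_set) (simp_all add: excluded_3_def del: wdesc.simps)
  also have "\<dots> = 204353655514"
    by (simp add: excluded_3_def wdesc_class dv_def class_wdesc_10 del: wdesc.simps)
  finally show "(\<Sum>m\<in>snd ` set excluded_3. wdesc small_squarefree 10 m) = 204353655514" .
  have "(\<Sum>m\<in>snd ` set excluded_4. wdesc small_squarefree 9 m)
      = (\<Sum>m\<leftarrow>map snd excluded_4. wdesc small_squarefree 9 m)"
    by (subst sum_list_distinct_conv_sum_set) (simp_all add: excluded_4_def del: wdesc.simps)
  also have "\<dots> = 201952920108"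
    by (simp add: excluded_4_def wdesc_class dv_def class_wdesc_9 del: wdesc.simps)
  finally show "(\<Sum>m\<in>snd ` set excluded_4. wdesc small_squarefree 9 m) = 201952920108" .
qed

lemma wdesc_nearly_squarefree_le: "wdesc nearly_squarefree 13 0 \<le> 27090796772703"
proof -
  define L where "L k = (\<Sum>m\<in>killed nearly_squarefree small_squarefree k. wdesc small_squarefree (13 - Suc k) m)" for k
  have "204353655514 \<le> L 2"
    unfolding L_def using sum_mono2[OF finite_killed excluded_3_killed, of "wdesc small_squarefree 10"]
    by (simp add: sum_excluded del: wdesc.simps)
  moreover have "201952920108 \<le> L 3"
    unfolding L_def using sum_mono2[OF finite_killed excluded_4_killed, of "wdesc small_squarefree 9"]
    by (simp add: sum_excluded del: wdesc.simps)
  moreover have "L 2 + L 3 \<le> (\<Sum>k<13. L k)"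
    using sum_mono2[of "{..<13}" "{2, 3}" L] by simp
  moreover have "nearly_squarefree m \<Longrightarrow> small_squarefree m" for m
    by (simp add: nearly_squarefree_def)
  then have "wdesc nearly_squarefree 13 0 + (\<Sum>k<13. L k) = 27497103348325"
    using wdesc_killed[of nearly_squarefree small_squarefree 13]
    by (simp add: L_def wdesc_small_0 class_wdesc_13 del: wdesc.simps)
  ultimately show ?thesis by linarith
qed

section \<open>Geometric estimate of the tail\<close>

lemma desc_small_13_le: "desc small_squarefree 13 m \<le> 58462776003"
proof -
  have "\<forall>s x. class_wdesc 13 s x \<le> 10 * class_wdesc 12 s x + 58462776003"
    by (simp_all only: dg_all class_wdesc_12 class_wdesc_13) simp
  then have "wdesc small_squarefree 13 m \<le> 10 * wdesc small_squarefree 12 m + 58462776003"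
    unfolding wdesc_class by blast
  then show ?thesis using wdesc_Suc_eq[of small_squarefree 12 m] by simp
qed

lemma sum_lessThan_add:
  fixes f :: "nat \<Rightarrow> 'a :: comm_monoid_add"
  shows "(\<Sum>k<n + m. f k) = (\<Sum>k<m. f k) + (\<Sum>k<n. f (k + m))"
  by (induction n) (simp_all add: add.assoc)

text \<open>With \<open>S\<close> a long enough partial sum and \<open>H\<close> the bound for its
  first 14 terms, \<open>S \<le> H + \<rho> * (S - 1)\<close>. As \<open>\<rho> < 1\<close>, this
  can be solved for \<open>S\<close>, and only finite sums occur.\<close>

lemma sum_desc_squarefree_le: "(\<Sum>k<n. real (desc squarefree k 0) / 10 ^ k) \<le> 2.720303756"
proof -
  define a where "a k = real (desc nearly_squarefree k 0) / 10 ^ k" for k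
  \<comment> \<open>A bound for the probability of surviving 13 further digits, uniform in the
    number reached.\<close>
  define \<rho> :: real where "\<rho> = 58462776003 / 10 ^ 13"
  have a_pos: "a k \<ge> 0" for k by (simp add: a_def)
  have a0: "a 0 = 1" by (simp add: a_def)
  have a13: "a (k + 13) \<le> \<rho> * a k" for k
  proof -
    have "desc nearly_squarefree 13 m \<le> 58462776003" for m
      using desc_mono[of nearly_squarefree small_squarefree 13 m] desc_small_13_le[of m]
      by (force simp: nearly_squarefree_def)
    then have "real (desc nearly_squarefree (k + 13) 0) \<le> 58462776003 * real (desc nearly_squarefree k 0)"
      using desc_add_le[of nearly_squarefree 13 58462776003 k 0] by (metis of_nat_le_iff of_nat_mult of_nat_numeral)
    then show ?thesis by (simp add: a_def \<rho>_def power_add divide_simps)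
  qed
  have head: "(\<Sum>k\<le>13. a k) \<le> 27090796772703 / 10 ^ 13"
  proof -
    have "10 ^ 13 * (\<Sum>k\<le>13. a k) = real (wdesc nearly_squarefree 13 0)"
      unfolding wdesc_real a_def ..
    also have "\<dots> \<le> 27090796772703" using wdesc_nearly_squarefree_le by linarith
    finally show ?thesis by simp
  qed
  have "(\<Sum>k<n. real (desc squarefree k 0) / 10 ^ k) \<le> (\<Sum>k<n. a k)"
    unfolding a_def
    by (intro sum_mono divide_right_mono) (auto intro!: desc_mono squarefree_imp_nearly_squarefree)
  \<comment> \<open>The added terms make sure that the head \<open>k \<le> 13\<close> is complete
    for every \<open>n\<close>.\<close>
  also have "\<dots> \<le> (\<Sum>k<n + 14. a k)"
    by (intro sum_mono2) (auto simp: a_pos)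
  also have "(\<Sum>k<n + 14. a k) \<le> 2.720303756"
  proof -
    define S where "S = (\<Sum>k<n + 14. a k)"
    have S: "S = (\<Sum>k<14. a k) + (\<Sum>k<n. a (k + 14))"
      unfolding S_def by (rule sum_lessThan_add)
    have "n + 14 = (n + 13) + 1" by simp
    then have "S = a 0 + (\<Sum>k<n + 13. a (k + 1))"
      unfolding S_def by (simp only: sum_lessThan_add) simp
    moreover have "(\<Sum>k<n. a (k + 1)) \<le> (\<Sum>k<n + 13. a (k + 1))"
      by (intro sum_mono2) (auto simp: a_pos)
    ultimately have tail: "(\<Sum>k<n. a (k + 1)) \<le> S - 1" using a0 by linarith
    \<comment> \<open>A shift by 13 pairs the tail, which begins at 14, with the terms from 1 on, so
      \<open>a 0 = 1\<close> can be subtracted from \<open>S\<close>.\<close>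
    have "(\<Sum>k<n. a (k + 14)) \<le> (\<Sum>k<n. \<rho> * a (k + 1))"
    proof (rule sum_mono)
      fix k :: nat
      have "k + 14 = (k + 1) + 13" by simp
      then show "a (k + 14) \<le> \<rho> * a (k + 1)" using a13[of "k + 1"] by presburger
    qed
    also have "\<dots> = \<rho> * (\<Sum>k<n. a (k + 1))" by (rule sum_distrib_left[symmetric])
    also have "\<dots> \<le> \<rho> * (S - 1)" using tail by (rule mult_left_mono) (simp add: \<rho>_def)
    finally have "S \<le> (\<Sum>k<14. a k) + \<rho> * (S - 1)" using S by linarith
    moreover have "{..<14::nat} = {..13}" by auto
    ultimately have "S \<le> 27090796772703 / 10 ^ 13 + \<rho> * (S - 1)" using head by simp
    then show ?thesis unfolding S_def[symmetric] \<rho>_def by (simp add: field_simps)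
  qed
  finally show ?thesis .
qed

theorem theorem3p9:
  shows "ennreal 2.63297479 \<le> expected_squarefree_walk_length 10 \<and>
         expected_squarefree_walk_length 10 \<le> ennreal 2.720303756"
proof
  let ?f = "\<lambda>k. real (desc squarefree k 0) / 10 ^ k"
  have partial: "(\<Sum>k<n. ennreal (?f k)) = ennreal (\<Sum>k<n. ?f k)" for n
    by (rule sum_ennreal) simp
  \<comment> \<open>Dividing by \<open>10 ^ 10\<close> gives the eleven terms with
    \<open>k \<le> 10\<close>.\<close>
  have "real 26329747900 \<le> real (wdesc squarefree 10 0)"
    using wdesc_squarefree_ge by (rule of_nat_mono)
  then have "2.63297479 \<le> (\<Sum>k\<le>10. ?f k)"
    unfolding wdesc_real by simp
  moreover have "{..<11::nat} = {..10}" by auto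
  ultimately have "2.63297479 \<le> (\<Sum>k<11. ?f k)" by simp
  then have "ennreal 2.63297479 \<le> (\<Sum>k<11. ennreal (?f k))"
    unfolding partial by (rule ennreal_leI)
  also have "\<dots> \<le> (\<Sum>k. ennreal (?f k))"
    by (rule sum_le_suminf) auto
  finally show "ennreal 2.63297479 \<le> expected_squarefree_walk_length 10"
    unfolding expected_squarefree_walk_length_eq .
  have "(\<Sum>k. ennreal (?f k)) \<le> ennreal 2.720303756"
    by (rule suminf_le_const, rule summableI, unfold partial, rule ennreal_leI, rule sum_desc_squarefree_le)
  then show "expected_squarefree_walk_length 10 \<le> ennreal 2.720303756"
    unfolding expected_squarefree_walk_length_eq .
qed

end
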